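(* For $\nu\in\mathbb{C}$ and $l,m\in\mathbb{N}=\{0,1,2,\ldots\}$, let $$t_{\nu,l}^m(z)=\frac{(2\nu+l)(\frac12)^{\nu+l+1}}{\sqrt\pi\,(\nu+l)\Gamma(\nu+l+\frac32)}\,(l)_m\,z^{l-m},\qquad u_{\nu,l}^m(z)=\frac{l\,(\frac12)^{\nu-l+1}}{\sqrt\pi\,(l-\nu)\Gamma(\nu-l+\frac32)}\,(2\nu-l)_m\,z^{2\nu-l-m},$$ $$v_{\nu,l}^m(z)=-\frac{\nu}{\pi(\nu+l)}\sin(\pi(\nu+l))\,(-\nu-1)_m\,z^{-\nu-m-1},\qquad w_{\nu,l}^m(z)=\frac{\nu}{\pi(\nu-l)}\sin(\pi(\nu-l))\,(\nu-1)_m\,z^{\nu-m-1},$$ and let $\tilde v_{\nu,l}^m$, $\tilde w_{\nu,l}^m$ be the functions obtained from $v_{\nu,l}^m$, $w_{\nu,l}^m$ by replacing $\sin(\pi(\nu\pm l))$ with $1-\cos(\pi(\nu\pm l))$. Here $(x)_m$ denotes the Pochhammer symbol $(x)_m=x(x+1)\cdots(x+m-1)$, with $(x)_0=1$. (i) Let $(G_\nu,P,Q)$ be any of the triples $(\mathbf{H}_\nu,t,u)$, $(\mathbf{J}_\nu,v,w)$, $(\mathbf{E}_\nu,\tilde v,\tilde w)$, where $\mathbf{H}_\nu$ is the Struve function, $\mathbf{J}_\nu$ the Anger function and $\mathbf{E}_\nu$ the Weber function. Then for $n\in\mathbb{N}$: $$\frac{\mathrm{d}^{2n}}{\mathrm{d}z^{2n}}\left(\frac{G_\nu(z)}{z^\nu}\right)=\sum_{k=0}^n(-1)^{n+k}A_k^n(\nu)\frac{G_{\nu+2k}(z)}{z^\nu}+\sum_{j=0}^{n-1}\sum_{k=0}^j(-1)^{k+j}A_k^j(\nu)P_{\nu,2k}^{2n-2j-1}(z)+\sum_{j=0}^{n-1}\sum_{k=0}^j(-1)^{k+j+1}B_k^j(\nu)P_{\nu,2k+1}^{2n-2j-2}(z),\quad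 \nu\in\mathbb{C}\setminus(-[2n-1]);$$ $$\frac{\mathrm{d}^{2n+1}}{\mathrm{d}z^{2n+1}}\left(\frac{G_\nu(z)}{z^\nu}\right)=\sum_{k=0}^n(-1)^{n+k+1}B_k^n(\nu)\frac{G_{\nu+2k+1}(z)}{z^\nu}+\sum_{j=0}^{n}\sum_{k=0}^j(-1)^{k+j}A_k^j(\nu)P_{\nu,2k}^{2n-2j}(z)+\sum_{j=0}^{n-1}\sum_{k=0}^j(-1)^{k+j+1}B_k^j(\nu)P_{\nu,2k+1}^{2n-2j-1}(z),\quad \nu\in\mathbb{C}\setminus(-[2n]);$$ $$\frac{\mathrm{d}^{2n}}{\mathrm{d}z^{2n}}(z^\nu G_\nu(z))=\sum_{k=0}^n(-1)^{n+k}A_k^n(-\nu)z^\nu G_{\nu-2k}(z)+\sum_{j=0}^{n-1}\sum_{k=0}^j(-1)^{k+j}A_k^j(-\nu)Q_{\nu,2k}^{2n-2j-1}(z)+\sum_{j=0}^{n-1}\sum_{k=0}^j(-1)^{k+j}B_k^j(-\nu)Q_{\nu,2k+1}^{2n-2j-2}(z),\quad \nu\in\mathbb{C}\setminus[2n-1];$$ $$\frac{\mathrm{d}^{2n+1}}{\mathrm{d}z^{2n+1}}(z^\nu G_\nu(z))=\sum_{k=0}^n(-1)^{n+k}B_k^n(-\nu)z^\nu G_{\nu-2k-1}(z)+\sum_{j=0}^{n}\sum_{k=0}^j(-1)^{k+j}A_k^j(-\nu)Q_{\nu,2k}^{2n-2j}(z)+\sum_{j=0}^{n-1}\sum_{k=0}^j(-1)^{k+j}B_k^j(-\nu)Q_{\nu,2k+1}^{2n-2j-1}(z),\quad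 \nu\in\mathbb{C}\setminus[2n].$$ (ii) Let $\mathbf{L}_\nu$ be the modified Struve function. Then for $n\in\mathbb{N}$: $$\frac{\mathrm{d}^{2n}}{\mathrm{d}z^{2n}}\left(\frac{\mathbf{L}_\nu(z)}{z^\nu}\right)=\sum_{k=0}^nA_k^n(\nu)\frac{\mathbf{L}_{\nu+2k}(z)}{z^\nu}+\sum_{j=0}^{n-1}\sum_{k=0}^jA_k^j(\nu)t_{\nu,2k}^{2n-2j-1}(z)+\sum_{j=0}^{n-1}\sum_{k=0}^jB_k^j(\nu)t_{\nu,2k+1}^{2n-2j-2}(z),\quad \nu\in\mathbb{C}\setminus(-[2n-1]);$$ $$\frac{\mathrm{d}^{2n+1}}{\mathrm{d}z^{2n+1}}\left(\frac{\mathbf{L}_\nu(z)}{z^\nu}\right)=\sum_{k=0}^nB_k^n(\nu)\frac{\mathbf{L}_{\nu+2k+1}(z)}{z^\nu}+\sum_{j=0}^{n}\sum_{k=0}^jA_k^j(\nu)t_{\nu,2k}^{2n-2j}(z)+\sum_{j=0}^{n-1}\sum_{k=0}^jB_k^j(\nu)t_{\nu,2k+1}^{2n-2j-1}(z),\quad \nu\in\mathbb{C}\setminus(-[2n]);$$ $$\frac{\mathrm{d}^{2n}}{\mathrm{d}z^{2n}}(z^\nu\mathbf{L}_\nu(z))=\sum_{k=0}^nA_k^n(-\nu)z^\nu\mathbf{L}_{\nu-2k}(z)+\sum_{j=0}^{n-1}\sum_{k=0}^jA_k^j(-\nu)u_{\nu,2k}^{2n-2j-1}(z)+\sum_{j=0}^{n-1}\sum_{k=0}^jB_k^j(-\nu)u_{\nu,2k+1}^{2n-2j-2}(z),\quad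 \nu\in\mathbb{C}\setminus[2n-1];$$ $$\frac{\mathrm{d}^{2n+1}}{\mathrm{d}z^{2n+1}}(z^\nu\mathbf{L}_\nu(z))=\sum_{k=0}^nB_k^n(-\nu)z^\nu\mathbf{L}_{\nu-2k-1}(z)+\sum_{j=0}^{n}\sum_{k=0}^jA_k^j(-\nu)u_{\nu,2k}^{2n-2j}(z)+\sum_{j=0}^{n-1}\sum_{k=0}^jB_k^j(-\nu)u_{\nu,2k+1}^{2n-2j-1}(z),\quad \nu\in\mathbb{C}\setminus[2n].$$
   Context: Standard definitions: $\mathbf{H}_\nu(z)=\sum_{k\ge0}\frac{(-1)^k(z/2)^{2k+\nu+1}}{\Gamma(k+\frac32)\Gamma(k+\nu+\frac32)}$, $\mathbf{L}_\nu(z)=\sum_{k\ge0}\frac{(z/2)^{2k+\nu+1}}{\Gamma(k+\frac32)\Gamma(k+\nu+\frac32)}$, $\mathbf{J}_\nu(z)=\frac1\pi\int_0^\pi\cos(\nu\theta-z\sin\theta)\,\mathrm{d}\theta$, $\mathbf{E}_\nu(z)=\frac1\pi\int_0^\pi\sin(\nu\theta-z\sin\theta)\,\mathrm{d}\theta$. Here $z\ne0$ is complex, all powers of $z$ use a common fixed branch, and $1/\Gamma$ is the entire reciprocal gamma function (zero at poles of $\Gamma$). In $P_{\nu,l}^m$, $Q_{\nu,l}^m$, $t_{\nu,l}^m$, $u_{\nu,l}^m$, $v_{\nu,l}^m$, $w_{\nu,l}^m$, $\tilde v_{\nu,l}^m$, $\tilde w_{\nu,l}^m$ the superscript $m$ is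 an index (not a power). When $\nu=l=0$ the convention $\frac{\nu}{\nu\pm l}=\frac00:=1$ is used, so that then $\frac{2\nu+l}{\nu+l}=1+\frac{\nu}{\nu+l}=2$ and $\frac{l}{l-\nu}=1-\frac{\nu}{\nu-l}=0$. For $n\in\mathbb{N}$, $0\le k\le n$ and $\nu\in\mathbb{C}$, define $$A_k^n(\nu)=\frac{(2n)!\,(\nu+2k)\prod_{j=0}^{k-1}(2\nu+2j+1)}{2^{2n-k}(2k)!\,(n-k)!\prod_{j=0}^n(\nu+k+j)},\qquad B_k^n(\nu)=\frac{(2n+1)!\,(\nu+2k+1)\prod_{j=0}^{k-1}(2\nu+2j+1)}{2^{2n-k}(2k+1)!\,(n-k)!\prod_{j=0}^n(\nu+k+j+1)},$$ with the empty product equal to $1$. The numerator factor $\nu+2k$ (resp. $\nu+2k+1$) is cancelled against the equal factor $j=k$ of the denominator product; thus $A_k^n(\nu)$ is defined for all $\nu$ other than the integers $-k,-(k+1),\ldots,-(k+n)$ different from $-2k$, and $B_k^n(\nu)$ for all $\nu$ other than the integers $-(k+1),\ldots,-(k+n+1)$ different from $-(2k+1)$. For $N\ge1$, $[N]=\{1,2,\ldots,N\}$ and $-[N]=\{-1,-2,\ldots,-N\}$; $[0],[-1],-[0],-[-1]$ are the empty set. $\sum_{k=0}^{-1}a_k=0$.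
   Formalization: The symbol (x)_m is taken as the descending product x(x-1)...(x-m+1) instead of the ascending x(x+1)...(x+m-1); with the ascending one the first formula fails for H_0 at n=2 (a spurious 1/z term appears). *)

theory Defs
  imports "HOL-Analysis.Analysis"
begin

text \<open>A continuous branch of the logarithm on an open set (which then cannot contain 0).
  All powers of \<open>z\<close> below are formed with one such branch, so every choice of
  branch is covered and not only the principal one.\<close>

definition log_branch_on :: "complex set \<Rightarrow> (complex \<Rightarrow> complex) \<Rightarrow> bool" where
  "log_branch_on S lg \<longleftrightarrow> open S \<and> continuous_on S lg \<and> (\<forall>z\<in>S. exp (lg z) = z)"

definition cpow :: "(complex \<Rightarrow> complex) \<Rightarrow> complex \<Rightarrow> complex \<Rightarrow> complex" where
  "cpow lg z a = exp (a * lg z)"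

text \<open>In the Struve functions \<open>(z/2)\<close> to the power \<open>a\<close> is read as
  \<open>cpow lg z a / 2 powr a\<close>, the power of the positive number 2 being the principal one.
  The function \<open>rGamma\<close> is the entire reciprocal Gamma function.\<close>

definition struve_H :: "(complex \<Rightarrow> complex) \<Rightarrow> complex \<Rightarrow> complex \<Rightarrow> complex" where
  "struve_H lg \<nu> z = (\<Sum>k. (-1) ^ k
      * (cpow lg z (2 * of_nat k + \<nu> + 1) / 2 powr (2 * of_nat k + \<nu> + 1))
      * rGamma (of_nat k + 3/2) * rGamma (of_nat k + \<nu> + 3/2))"

definition struve_L :: "(complex \<Rightarrow> complex) \<Rightarrow> complex \<Rightarrow> complex \<Rightarrow> complex" where
  "struve_L lg \<nu> z = (\<Sum>k.
      (cpow lg z (2 * of_nat k + \<nu> + 1) / 2 powr (2 * of_nat k + \<nu> + 1))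
      * rGamma (of_nat k + 3/2) * rGamma (of_nat k + \<nu> + 3/2))"

definition anger_J :: "complex \<Rightarrow> complex \<Rightarrow> complex" where
  "anger_J \<nu> z = 1 / of_real pi
      * integral {0..pi} (\<lambda>\<theta>. cos (\<nu> * of_real \<theta> - z * of_real (sin \<theta>)))"

definition weber_E :: "complex \<Rightarrow> complex \<Rightarrow> complex" where
  "weber_E \<nu> z = 1 / of_real pi
      * integral {0..pi} (\<lambda>\<theta>. sin (\<nu> * of_real \<theta> - z * of_real (sin \<theta>)))"

text \<open>The factor \<open>\<nu> + 2k\<close> (resp. \<open>\<nu> + 2k + 1\<close>) of the usual numerator is cancelled against
  the factor \<open>j = k\<close> of the denominator, which is why \<open>k\<close> is omitted from the product.\<close>

definition coeff_A :: "nat \<Rightarrow> nat \<Rightarrow> complex \<Rightarrow> complex" where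
  "coeff_A n k \<nu> =
     fact (2 * n) * (\<Prod>j<k. 2 * \<nu> + 2 * of_nat j + 1)
     / (2 ^ (2 * n - k) * fact (2 * k) * fact (n - k)
        * (\<Prod>j\<in>{0..n} - {k}. \<nu> + of_nat k + of_nat j))"

definition coeff_B :: "nat \<Rightarrow> nat \<Rightarrow> complex \<Rightarrow> complex" where
  "coeff_B n k \<nu> =
     fact (2 * n + 1) * (\<Prod>j<k. 2 * \<nu> + 2 * of_nat j + 1)
     / (2 ^ (2 * n - k) * fact (2 * k + 1) * fact (n - k)
        * (\<Prod>j\<in>{0..n} - {k}. \<nu> + of_nat k + of_nat j + 1))"

text \<open>The factor \<open>(x)\<^sub>m\<close> in \<open>t\<close>, \<open>u\<close>, \<open>v\<close>, \<open>w\<close> is the one produced by differentiating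
  a power \<open>m\<close> times, the descending product \<open>x (x - 1) \<dots> (x - m + 1)\<close>: each of
  these functions of index \<open>m\<close> is the \<open>m\<close>-th derivative of the one of index 0.
  The ascending product \<open>pochhammer x m\<close> agrees with it for \<open>m \<le> 1\<close> but would make the
  derivative formulas false: for \<open>\<nu> = 0\<close> it adds a term \<open>-2 / (3 \<pi> z)\<close> to the
  fourth derivative of \<open>struve_H lg 0 z\<close>.\<close>

definition desc_fact :: "complex \<Rightarrow> nat \<Rightarrow> complex" where
  "desc_fact x m = (\<Prod>i<m. x - of_nat i)"

text \<open>The case distinctions implement the convention that \<open>\<nu> / (\<nu> \<plusminus> l)\<close> is 1
  for \<open>\<nu> = l = 0\<close>.\<close>

definition t_fun :: "(complex \<Rightarrow> complex) \<Rightarrow> complex \<Rightarrow> nat \<Rightarrow> nat \<Rightarrow> complex \<Rightarrow> complex" where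
  "t_fun lg \<nu> l m z =
     (if \<nu> = 0 \<and> l = 0 then 2 else (2 * \<nu> + of_nat l) / (\<nu> + of_nat l))
     * (1/2) powr (\<nu> + of_nat l + 1) / of_real (sqrt pi) * rGamma (\<nu> + of_nat l + 3/2)
     * desc_fact (of_nat l) m * cpow lg z (of_nat l - of_nat m)"

definition u_fun :: "(complex \<Rightarrow> complex) \<Rightarrow> complex \<Rightarrow> nat \<Rightarrow> nat \<Rightarrow> complex \<Rightarrow> complex" where
  "u_fun lg \<nu> l m z =
     (if \<nu> = 0 \<and> l = 0 then 0 else of_nat l / (of_nat l - \<nu>))
     * (1/2) powr (\<nu> - of_nat l + 1) / of_real (sqrt pi) * rGamma (\<nu> - of_nat l + 3/2)
     * desc_fact (2 * \<nu> - of_nat l) m * cpow lg z (2 * \<nu> - of_nat l - of_nat m)"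

text \<open>The parameter \<open>T\<close> is \<open>sin\<close> for \<open>v\<close>, \<open>w\<close>, and \<open>\<lambda>x. 1 - cos x\<close> for their variants
  with a tilde.\<close>

definition v_gen :: "(complex \<Rightarrow> complex) \<Rightarrow> (complex \<Rightarrow> complex)
    \<Rightarrow> complex \<Rightarrow> nat \<Rightarrow> nat \<Rightarrow> complex \<Rightarrow> complex" where
  "v_gen T lg \<nu> l m z =
     - (1 / of_real pi) * (if \<nu> = 0 \<and> l = 0 then 1 else \<nu> / (\<nu> + of_nat l))
     * T (of_real pi * (\<nu> + of_nat l))
     * desc_fact (- \<nu> - 1) m * cpow lg z (- \<nu> - of_nat m - 1)"

definition w_gen :: "(complex \<Rightarrow> complex) \<Rightarrow> (complex \<Rightarrow> complex)
    \<Rightarrow> complex \<Rightarrow> nat \<Rightarrow> nat \<Rightarrow> complex \<Rightarrow> complex" where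
  "w_gen T lg \<nu> l m z =
     (1 / of_real pi) * (if \<nu> = 0 \<and> l = 0 then 1 else \<nu> / (\<nu> - of_nat l))
     * T (of_real pi * (\<nu> - of_nat l))
     * desc_fact (\<nu> - 1) m * cpow lg z (\<nu> - of_nat m - 1)"

abbreviation "v_fun \<equiv> v_gen sin"
abbreviation "w_fun \<equiv> w_gen sin"
abbreviation "v_tilde \<equiv> v_gen (\<lambda>x. 1 - cos x)"
abbreviation "w_tilde \<equiv> w_gen (\<lambda>x. 1 - cos x)"

end

theory Submission
  imports Defs
begin

text \<open>
  Each of the four functions satisfies a pair of inhomogeneous three-term recurrences, for
  \<open>G (\<mu> - 1) x \<plusminus> \<sigma> * G (\<mu> + 1) x\<close> with \<open>\<sigma> = 1\<close> for the modified Struve function and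
  \<open>\<sigma> = -1\<close> otherwise. Eliminating \<open>\<nu> / x\<close> from the derivative of
  \<open>g\<^sub>l = G (\<nu> + l) x / x\<^sup>\<nu>\<close> gives
  \<open>g\<^sub>l' = (1 - r) / 2 * g\<^sub>l\<^sub>-\<^sub>1 + \<sigma> * (1 + r) / 2 * g\<^sub>l\<^sub>+\<^sub>1 + P\<^sub>l\<close> with \<open>r = \<nu> / (\<nu> + l)\<close>, and the
  functions \<open>x\<^sup>\<nu> * G (\<nu> - l) x\<close> satisfy the same relation with \<open>-\<nu>\<close> for \<open>\<nu>\<close> and the two
  signs exchanged. Iterating this relation \<open>N\<close> times from \<open>g\<^sub>0\<close> is a weighted count of lattice
  paths; up to sign, the weights for even and odd \<open>N\<close> are the numbers \<open>A\<close> and \<open>B\<close>.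
\<close>

section \<open>The coefficients A and B\<close>

text \<open>The orders at which a denominator vanishes shape the proof. Since r = 1 at l = 0, the
  downward step from site 0 has weight 0, so the walk never leaves the sites l \<ge> 0. A walk of N
  steps departs only from sites below N, so the N-th derivative asks for \<nu> + l \<noteq> 0 only
  when 1 \<le> l < N; this is the origin of the excluded sets. Two delicate orders stay permitted:
  \<nu> = 0 and \<nu> = -N, at which the factor cancelled in the lowest A or in the top coefficient
  vanishes. The recursion of the weights becomes, once common factors are removed, one of two
  identities linear in \<nu>: (2n+1)(\<nu>+2k+1) = (n-k)(2\<nu>+2k+1) + (2k+1)(\<nu>+k+n+1) and
  (n+1)(\<nu>+2k+2) = (n-k)(\<nu>+k+1) + (k+1)(\<nu>+k+n+2). The double sums come from the
  inhomogeneous terms: one that enters between the i-th and the (i+1)-th derivative is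
  differentiated N-1-i more times.\<close>

definition ratio :: "complex \<Rightarrow> nat \<Rightarrow> complex" where
  "ratio \<nu> l = (if \<nu> = 0 \<and> l = 0 then 1 else \<nu> / (\<nu> + of_nat l))"

text \<open>\<open>dcoeff a b \<nu> N l\<close> is the coefficient of \<open>g\<^sub>l\<close> in the \<open>N\<close>-th derivative of \<open>g\<^sub>0\<close>;
  \<open>a\<close> and \<open>b\<close> carry the signs of the downward and the upward step.\<close>

fun dcoeff :: "complex \<Rightarrow> complex \<Rightarrow> complex \<Rightarrow> nat \<Rightarrow> nat \<Rightarrow> complex" where
  "dcoeff a b \<nu> 0 l = (if l = 0 then 1 else 0)"
| "dcoeff a b \<nu> (Suc N) l = a * ((1 - ratio \<nu> (Suc l)) / 2) * dcoeff a b \<nu> N (Suc l)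
     + (case l of 0 \<Rightarrow> 0 | Suc l' \<Rightarrow> b * ((1 + ratio \<nu> l') / 2) * dcoeff a b \<nu> N l')"

lemma ratio_0 [simp]: "ratio \<nu> 0 = 1"
  by (simp add: ratio_def)

text \<open>The product form includes \<nu> = l = 0, where the conventional value 1 also works. It
  is what later trades \<nu> / x for r times (\<nu> + l) / x.\<close>

lemma ratio_times: "l = 0 \<or> \<nu> + of_nat l \<noteq> 0 \<Longrightarrow> ratio \<nu> l * (\<nu> + of_nat l) = \<nu>"
  by (auto simp: ratio_def)

lemma half_ratio:
  assumes "\<nu> + of_nat l \<noteq> 0"
  shows "(1 - ratio \<nu> l) / 2 = of_nat l / (2 * (\<nu> + of_nat l))"
    and "(1 + ratio \<nu> l) / 2 = (2 * \<nu> + of_nat l) / (2 * (\<nu> + of_nat l))"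
proof -
  define w where "w = \<nu> + of_nat l"
  have "ratio \<nu> l = \<nu> / w" "\<nu> = w - of_nat l" "w \<noteq> 0"
    using assms by (auto simp: ratio_def w_def)
  then show "(1 - ratio \<nu> l) / 2 = of_nat l / (2 * (\<nu> + of_nat l))"
    and "(1 + ratio \<nu> l) / 2 = (2 * \<nu> + of_nat l) / (2 * (\<nu> + of_nat l))"
    unfolding \<open>ratio \<nu> l = _\<close> w_def[symmetric] by (simp_all add: field_simps)
qed

lemma dcoeff_eq_0: "N < l \<Longrightarrow> dcoeff a b \<nu> N l = 0"
  by (induction N arbitrary: l) (auto split: nat.split intro: odd_pos)

lemma dcoeff_parity: "odd (N + l) \<Longrightarrow> dcoeff a b \<nu> N l = 0"
  by (induction N arbitrary: l) (auto split: nat.split intro: odd_pos)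

section \<open>The products in A and B as Pochhammer symbols\<close>

lemma prod_remove_pochhammer:
  fixes x :: complex
  assumes "k \<le> n" "x + of_nat k \<noteq> 0"
  shows "(\<Prod>j\<in>{0..n} - {k}. x + of_nat j) = pochhammer x (Suc n) / (x + of_nat k)"
proof -
  have "pochhammer x (Suc n) = (x + of_nat k) * (\<Prod>j\<in>{0..n} - {k}. x + of_nat j)"
    using assms(1) unfolding pochhammer_Suc_prod by (intro prod.remove) auto
  then show ?thesis using assms(2) by (simp add: field_simps)
qed

lemma prod_remove_last:
  fixes x :: complex
  shows "(\<Prod>j\<in>{0..n} - {n}. x + of_nat j) = pochhammer x n"
proof -
  have "{0..n} - {n} = {0..<n}" by auto
  then show ?thesis by (simp add: pochhammer_prod)
qed

lemma prod_remove_first: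
  fixes x :: complex
  shows "(\<Prod>j\<in>{0..n} - {0}. x + of_nat j) = pochhammer (x + 1) n"
proof -
  have "{0..n} - {0} = Suc ` {0..<n}" by auto
  then show ?thesis by (simp add: pochhammer_prod prod.reindex add_ac del: prod.op_ivl_Suc image_Suc_atLeastLessThan)
qed

abbreviation onum :: "complex \<Rightarrow> nat \<Rightarrow> complex" where
  "onum \<nu> k \<equiv> \<Prod>j<k. 2 * \<nu> + 2 * of_nat j + 1"

lemma coeff_A_generic:
  assumes "k \<le> n" "\<nu> + of_nat (2 * k) \<noteq> 0"
  shows "coeff_A n k \<nu> = fact (2 * n) * onum \<nu> k * (\<nu> + of_nat (2 * k))
     / (2 ^ (2 * n - k) * fact (2 * k) * fact (n - k) * pochhammer (\<nu> + of_nat k) (Suc n))"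
proof -
  have e: "\<nu> + of_nat k + of_nat k = \<nu> + of_nat (2 * k)" by simp
  have p: "(\<Prod>j\<in>{0..n} - {k}. \<nu> + of_nat k + of_nat j)
      = pochhammer (\<nu> + of_nat k) (Suc n) / (\<nu> + of_nat (2 * k))"
    using prod_remove_pochhammer[of k n "\<nu> + of_nat k"] assms unfolding e by blast
  show ?thesis
    unfolding coeff_A_def p by simp
qed

lemma coeff_A_0: "coeff_A n 0 \<nu> = fact (2 * n) / (2 ^ (2 * n) * fact n * pochhammer (\<nu> + 1) n)"
  unfolding coeff_A_def of_nat_0 add_0_right prod_remove_first by simp

text \<open>Here the deleted factor is \<nu> + 2n. The order \<nu> = -2n is permitted in the
  derivative of order 2n, so the top coefficient gets a formula free of nonvanishing hypotheses;
  \<open>coeff_B_last\<close> does the same for \<nu> = -(2n+1).\<close>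

lemma coeff_A_last: "coeff_A n n \<nu> = onum \<nu> n / (2 ^ n * pochhammer (\<nu> + of_nat n) n)"
proof -
  have "2 * n - n = n" by simp
  then show ?thesis unfolding coeff_A_def prod_remove_last by simp
qed

lemma coeff_B_generic:
  assumes "k \<le> n" "\<nu> + of_nat (2 * k + 1) \<noteq> 0"
  shows "coeff_B n k \<nu> = fact (2 * n + 1) * onum \<nu> k * (\<nu> + of_nat (2 * k + 1))
     / (2 ^ (2 * n - k) * fact (2 * k + 1) * fact (n - k) * pochhammer (\<nu> + of_nat k + 1) (Suc n))"
proof -
  have e: "\<nu> + of_nat k + 1 + of_nat k = \<nu> + of_nat (2 * k + 1)" by simp
  have "\<nu> + of_nat k + of_nat j + 1 = \<nu> + of_nat k + 1 + of_nat j" for j by simp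
  then have p: "(\<Prod>j\<in>{0..n} - {k}. \<nu> + of_nat k + of_nat j + 1)
      = pochhammer (\<nu> + of_nat k + 1) (Suc n) / (\<nu> + of_nat (2 * k + 1))"
    using prod_remove_pochhammer[of k n "\<nu> + of_nat k + 1"] assms unfolding e by (simp only: simp_thms)
  show ?thesis
    unfolding coeff_B_def p by (simp del: fact_Suc)
qed

lemma coeff_B_last: "coeff_B n n \<nu> = onum \<nu> n / (2 ^ n * pochhammer (\<nu> + of_nat n + 1) n)"
proof -
  have "\<nu> + of_nat n + of_nat j + 1 = \<nu> + of_nat n + 1 + of_nat j" for j by simp
  then have "(\<Prod>j\<in>{0..n} - {n}. \<nu> + of_nat n + of_nat j + 1) = pochhammer (\<nu> + of_nat n + 1) n"
    using prod_remove_last[of "\<nu> + of_nat n + 1" n] by (simp only:)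
  moreover have "2 * n - n = n" by simp
  ultimately show ?thesis
    unfolding coeff_B_def by (simp del: fact_Suc)
qed

section \<open>Recurrences linking A and B\<close>

lemma pochhammer_nonzero:
  fixes \<nu> :: complex
  assumes "\<And>i. 1 \<le> i \<Longrightarrow> i \<le> N \<Longrightarrow> \<nu> + of_nat i \<noteq> 0" "1 \<le> s" "s + m \<le> N + 1"
  shows "pochhammer (\<nu> + of_nat s) m \<noteq> 0"
proof
  assume "pochhammer (\<nu> + of_nat s) m = 0"
  then obtain j where "j < m" "\<nu> + of_nat s = - of_nat j"
    by (auto simp: pochhammer_eq_0_iff)
  then have "\<nu> + of_nat (s + j) = 0" by (simp add: add.assoc[symmetric])
  with assms(1)[of "s + j"] assms(2,3) \<open>j < m\<close> show False by simp
qed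

text \<open>The upward weight is (\<nu>+k)/(\<nu>+2k): its denominator cancels the numerator factor
  of A and its numerator the first factor of the Pochhammer symbol. For k = 0 the weight is 1 and
  the endpoint formula gives the same right-hand side, even at \<nu> = 0.\<close>

lemma half_one_plus_ratio_coeff_A:
  assumes "\<And>i. 1 \<le> i \<Longrightarrow> i \<le> 2 * n \<Longrightarrow> \<nu> + of_nat i \<noteq> 0" "k \<le> n"
  shows "(1 + ratio \<nu> (2 * k)) / 2 * coeff_A n k \<nu> = fact (2 * n) * onum \<nu> k
     / (2 ^ (2 * n - k) * fact (2 * k) * fact (n - k) * pochhammer (\<nu> + of_nat k + 1) n)"
proof (cases "k = 0")
  case True
  then show ?thesis by (simp add: coeff_A_0)
next
  case False
  have nz: "\<nu> + of_nat k \<noteq> 0" "\<nu> + of_nat (2 * k) \<noteq> 0"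
    using assms(1)[of k] assms(1)[of "2 * k"] assms(2) False by auto
  have r: "(1 + ratio \<nu> (2 * k)) / 2 = (\<nu> + of_nat k) / (\<nu> + of_nat (2 * k))"
    unfolding half_ratio[OF nz(2)]
    using mult_divide_mult_cancel_left[of 2 "\<nu> + of_nat k" "\<nu> + of_nat (2 * k)"]
    by (simp add: distrib_left)
  have p: "pochhammer (\<nu> + of_nat k) (Suc n) = (\<nu> + of_nat k) * pochhammer (\<nu> + of_nat k + 1) n"
    by (rule pochhammer_rec)
  have "x / y * (F * y / (W * (x * X))) = F / (W * X)"
    if "x \<noteq> 0" "y \<noteq> 0" for x y F W X :: complex
    using that by simp
  from this[OF nz] show ?thesis
    unfolding r coeff_A_generic[OF assms(2) nz(2)] p .
qed

text \<open>The odd site 2k+1 is entered from 2k+2 by a step down and from 2k by a step up.\<close>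

lemma coeff_B_rec:
  assumes nz: "\<And>i. 1 \<le> i \<Longrightarrow> i \<le> 2 * n \<Longrightarrow> \<nu> + of_nat i \<noteq> 0" and k: "k < n"
  shows "coeff_B n k \<nu> = (1 - ratio \<nu> (2 * k + 2)) / 2 * coeff_A n (Suc k) \<nu>
     + (1 + ratio \<nu> (2 * k)) / 2 * coeff_A n k \<nu>"
proof -
  obtain d where d: "n = Suc (k + d)" using less_imp_Suc_add[OF k] by blast
  define X where "X = pochhammer (\<nu> + of_nat k + 1) n"
  have X: "X \<noteq> 0"
    using pochhammer_nonzero[of "2 * n" \<nu> "k + 1" n] nz k by (simp add: X_def add_ac)
  define y1 where "y1 = \<nu> + of_nat (2 * k + 1)"
  define y2 where "y2 = \<nu> + of_nat (2 * k + 2)"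
  define y3 where "y3 = \<nu> + of_nat (k + 1 + n)"
  have y: "y1 \<noteq> 0" "y2 \<noteq> 0" "y3 \<noteq> 0"
    using nz[of "2 * k + 1"] nz[of "2 * k + 2"] nz[of "k + 1 + n"] k
    unfolding y1_def y2_def y3_def by auto
  have po: "pochhammer (\<nu> + of_nat k + 1) (Suc n) = X * y3"
    using pochhammer_rec'[of "\<nu> + of_nat k + 1" n] by (simp add: X_def y3_def add_ac mult_ac)
  have r: "(1 - ratio \<nu> (2 * k + 2)) / 2 = of_nat (Suc k) / y2"
  proof -
    have e: "of_nat (2 * k + 2) = (2 * of_nat (Suc k) :: complex)" by simp
    show ?thesis
      unfolding half_ratio(1)[OF y(2)[unfolded y2_def]] y2_def[symmetric] unfolding e by (simp del: of_nat_Suc)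
  qed
  have A: "coeff_A n (Suc k) \<nu> = fact (2 * n) * onum \<nu> (Suc k) * y2
     / (2 ^ (2 * n - Suc k) * fact (2 * k + 2) * fact (n - Suc k) * (X * y3))"
    using coeff_A_generic[of "Suc k" n \<nu>] y(2) k po
    by (simp add: y2_def add_ac del: fact_Suc prod.lessThan_Suc)
  have B: "coeff_B n k \<nu> = fact (2 * n + 1) * onum \<nu> k * y1
     / (2 ^ (2 * n - k) * fact (2 * k + 1) * fact (n - k) * (X * y3))"
    using coeff_B_generic[of k n \<nu>] y k po by (simp add: y1_def del: fact_Suc)
  have e: "2 * n - k = Suc (2 * n - Suc k)" "n - k = Suc d" "n - Suc k = d" using d by auto
  \<comment> \<open>Integers, factorials and powers of 2 become opaque symbols, so that what remains
    is an identity of rational expressions.\<close>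
  define N1 where "N1 = (of_nat (2 * n + 1) :: complex)"
  define K1 where "K1 = (of_nat (2 * k + 1) :: complex)"
  define K2 where "K2 = (of_nat (Suc k) :: complex)"
  define D where "D = (of_nat (Suc d) :: complex)"
  define F where "F = (fact (2 * n) :: complex)"
  define H where "H = (fact (2 * k) :: complex)"
  define K where "K = (fact d :: complex)"
  define W where "W = (2 :: complex) ^ (2 * n - Suc k)"
  have f: "(fact (2 * n + 1) :: complex) = N1 * F"
    "(fact (2 * k + 1) :: complex) = K1 * H"
    "(fact (2 * k + 2) :: complex) = 2 * K2 * (K1 * H)"
    "(fact (Suc d) :: complex) = D * K"
    "(2 :: complex) ^ Suc (2 * n - Suc k) = 2 * W"
    "(2 :: complex) ^ (2 * n - Suc k) = W"
    by (simp_all add: F_def H_def K_def W_def N1_def K1_def K2_def D_def algebra_simps)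
  have nz2: "F \<noteq> 0" "H \<noteq> 0" "K \<noteq> 0" "W \<noteq> 0" by (simp_all add: F_def H_def K_def W_def)
  have nz3: "N1 \<noteq> 0" "K1 \<noteq> 0" "K2 \<noteq> 0" "D \<noteq> 0"
    unfolding N1_def K1_def K2_def D_def of_nat_eq_0_iff by auto
  define Z where "Z = 2 * \<nu> + of_nat (2 * k + 1)"
  have on: "onum \<nu> (Suc k) = onum \<nu> k * Z" by (simp add: Z_def)
  \<comment> \<open>The whole recurrence rests on this identity; its two summands become the
    contributions of 2k+2 and of 2k.\<close>
  have main: "N1 * y1 = D * Z + K1 * y3"
    by (simp add: N1_def D_def K1_def Z_def y1_def y3_def d algebra_simps)
  have B': "coeff_B n k \<nu> = N1 * F * onum \<nu> k * y1
     / (2 * W * (K1 * H) * (D * K) * (X * y3))"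
    unfolding B e f ..
  have A': "coeff_A n (Suc k) \<nu> = F * (onum \<nu> k * Z) * y2
     / (W * (2 * K2 * (K1 * H)) * K * (X * y3))"
    unfolding A e f on F_def K_def ..
  define U where "U = F * onum \<nu> k / (2 * W * H * K * X)"
  have "coeff_B n k \<nu> = U * (N1 * y1) / (K1 * D * y3)"
    unfolding B' U_def by (simp add: mult_ac)
  also have "\<dots> = U * Z / (K1 * y3) + U / D"
    using nz3 y unfolding main by (simp add: divide_simps) (simp add: algebra_simps)
  also have "U * Z / (K1 * y3) = K2 / y2 * coeff_A n (Suc k) \<nu>"
    using nz2 nz3 y X unfolding A' U_def by (simp add: divide_simps)
  also have "U / D = (1 + ratio \<nu> (2 * k)) / 2 * coeff_A n k \<nu>"
  proof -
    have "(1 + ratio \<nu> (2 * k)) / 2 * coeff_A n k \<nu> = F * onum \<nu> k / (2 * W * H * (D * K) * X)"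
      using half_one_plus_ratio_coeff_A[OF nz less_imp_le[OF k]]
      unfolding e f F_def[symmetric] H_def[symmetric] X_def[symmetric] by simp
    then show ?thesis unfolding U_def by (simp add: mult_ac)
  qed
  finally show ?thesis unfolding r K2_def .
qed

lemma coeff_B_rec_last:
  assumes "\<And>i. 1 \<le> i \<Longrightarrow> i \<le> 2 * n \<Longrightarrow> \<nu> + of_nat i \<noteq> 0"
  shows "coeff_B n n \<nu> = (1 + ratio \<nu> (2 * n)) / 2 * coeff_A n n \<nu>"
  using half_one_plus_ratio_coeff_A[OF assms order_refl] by (simp add: coeff_B_last)

text \<open>Site 0 can only be entered from site 1. The ratio (2n+2)!/(2n+1)! = 2(n+1) absorbs the
  new factor of (n+1)! and one power of 2.\<close>

lemma coeff_A_rec_0: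
  assumes "\<nu> + 1 \<noteq> 0"
  shows "coeff_A (Suc n) 0 \<nu> = (1 - ratio \<nu> 1) / 2 * coeff_B n 0 \<nu>"
proof -
  have nz: "\<nu> + of_nat 1 \<noteq> 0" using assms by simp
  have r: "(1 - ratio \<nu> 1) / 2 = 1 / (2 * (\<nu> + 1))"
    unfolding half_ratio(1)[OF nz] by simp
  have "fact (2 * Suc n) = 2 * of_nat (Suc n) * (fact (2 * n + 1) :: complex)"
    by (simp add: algebra_simps)
  then have "coeff_A (Suc n) 0 \<nu> = 2 * of_nat (Suc n) * fact (2 * n + 1)
      / (4 * 2 ^ (2 * n) * (of_nat (Suc n) * fact n) * pochhammer (\<nu> + 1) (Suc n))"
    by (simp add: coeff_A_0 fact_Suc[of n] del: fact_Suc of_nat_Suc)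
  also have "\<dots> = fact (2 * n + 1) / (2 * 2 ^ (2 * n) * fact n * pochhammer (\<nu> + 1) (Suc n))"
    by (simp add: field_simps del: of_nat_Suc fact_Suc)
  also have "\<dots> = 1 / (2 * (\<nu> + 1)) * coeff_B n 0 \<nu>"
    using assms coeff_B_generic[of 0 n \<nu>]
    by (simp del: fact_Suc distrib_left_numeral add: mult.assoc)
  finally show ?thesis unfolding r .
qed

lemma coeff_A_rec_last:
  assumes "\<nu> + of_nat (2 * n + 1) \<noteq> 0"
  shows "coeff_A (Suc n) (Suc n) \<nu> = (1 + ratio \<nu> (2 * n + 1)) / 2 * coeff_B n n \<nu>"
proof -
  have r: "(1 + ratio \<nu> (2 * n + 1)) / 2 = (2 * \<nu> + 2 * of_nat n + 1) / (2 * (\<nu> + of_nat (2 * n + 1)))"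
    unfolding half_ratio(2)[OF assms] by (simp add: add_ac)
  have "pochhammer (\<nu> + of_nat (Suc n)) (Suc n)
      = pochhammer (\<nu> + of_nat n + 1) n * (\<nu> + of_nat (2 * n + 1))"
    using pochhammer_rec'[of "\<nu> + of_nat n + 1" n] by (simp add: add_ac mult_ac)
  then show ?thesis unfolding r coeff_A_last coeff_B_last by (simp add: mult_ac)
qed

text \<open>The even site 2k+2 is entered from 2k+3 and from 2k+1. All three Pochhammer symbols
  share the factor \<open>Y\<close> and differ only by the end factors \<open>z1\<close> and
  \<open>z2\<close>.\<close>

lemma coeff_A_rec:
  assumes nz: "\<And>i. 1 \<le> i \<Longrightarrow> i \<le> 2 * n + 1 \<Longrightarrow> \<nu> + of_nat i \<noteq> 0" and k: "k < n"
  shows "coeff_A (Suc n) (Suc k) \<nu> = (1 - ratio \<nu> (2 * k + 3)) / 2 * coeff_B n (Suc k) \<nu>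
     + (1 + ratio \<nu> (2 * k + 1)) / 2 * coeff_B n k \<nu>"
proof -
  obtain d where d: "n = Suc (k + d)" using less_imp_Suc_add[OF k] by blast
  define Y where "Y = pochhammer (\<nu> + of_nat k + 2) n"
  have Y: "Y \<noteq> 0"
    using pochhammer_nonzero[of "2 * n + 1" \<nu> "k + 2" n] nz k by (simp add: Y_def add_ac)
  define y1 where "y1 = \<nu> + of_nat (2 * k + 1)"
  define y2 where "y2 = \<nu> + of_nat (2 * k + 2)"
  define y3 where "y3 = \<nu> + of_nat (2 * k + 3)"
  define z1 where "z1 = \<nu> + of_nat (k + 1)"
  define z2 where "z2 = \<nu> + of_nat (k + 2 + n)"
  have y: "y1 \<noteq> 0" "y2 \<noteq> 0" "y3 \<noteq> 0" "z1 \<noteq> 0" "z2 \<noteq> 0"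
    using nz[of "2 * k + 1"] nz[of "2 * k + 2"] nz[of "2 * k + 3"] nz[of "k + 1"] nz[of "k + 2 + n"] k
    unfolding y1_def y2_def y3_def z1_def z2_def by auto
  have po1: "pochhammer (\<nu> + of_nat k + 1) (Suc n) = z1 * Y"
    using pochhammer_rec[of "\<nu> + of_nat k + 1" n] by (simp add: Y_def z1_def add_ac)
  have po2: "pochhammer (\<nu> + of_nat (Suc k) + 1) (Suc n) = Y * z2"
    using pochhammer_rec'[of "\<nu> + of_nat k + 2" n] by (simp add: Y_def z2_def add_ac mult_ac)
  have po3: "pochhammer (\<nu> + of_nat (Suc k)) (Suc (Suc n)) = z1 * (Y * z2)"
    using po2 pochhammer_rec[of "\<nu> + of_nat k + 1" "Suc n"] by (simp add: z1_def add_ac)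
  have r1: "(1 - ratio \<nu> (2 * k + 3)) / 2 = of_nat (2 * k + 3) / (2 * y3)"
    unfolding half_ratio(1)[OF y(3)[unfolded y3_def]] y3_def ..
  have r2: "(1 + ratio \<nu> (2 * k + 1)) / 2 = (2 * \<nu> + of_nat (2 * k + 1)) / (2 * y1)"
    unfolding half_ratio(2)[OF y(1)[unfolded y1_def]] y1_def ..
  define N1 where "N1 = (of_nat (2 * n + 1) :: complex)"
  define N2 where "N2 = (of_nat (Suc n) :: complex)"
  define K1 where "K1 = (of_nat (2 * k + 1) :: complex)"
  define K2 where "K2 = (of_nat (Suc k) :: complex)"
  define K3 where "K3 = (of_nat (2 * k + 3) :: complex)"
  define D where "D = (of_nat (Suc d) :: complex)"
  define F where "F = (fact (2 * n) :: complex)"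
  define H where "H = (fact (2 * k) :: complex)"
  define K where "K = (fact d :: complex)"
  define W where "W = (2 :: complex) ^ (2 * n - Suc k)"
  have e: "2 * n - k = Suc (2 * n - Suc k)" "n - k = Suc d" "n - Suc k = d"
     "Suc n - Suc k = Suc d" "2 * Suc n - Suc k = Suc (Suc (2 * n - Suc k))" using d by auto
  have f: "(fact (2 * n + 1) :: complex) = N1 * F"
    "(fact (2 * Suc n) :: complex) = 2 * N2 * (N1 * F)"
    "(fact (2 * k + 1) :: complex) = K1 * H"
    "(fact (2 * Suc k) :: complex) = 2 * K2 * (K1 * H)"
    "(fact (2 * Suc k + 1) :: complex) = K3 * (2 * K2 * (K1 * H))"
    "(fact (Suc d) :: complex) = D * K"
    "(2 :: complex) ^ Suc (2 * n - Suc k) = 2 * W"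
    "(2 :: complex) ^ Suc (Suc (2 * n - Suc k)) = 4 * W"
    "(2 :: complex) ^ (2 * n - Suc k) = W"
    by (simp_all add: F_def H_def K_def W_def N1_def N2_def K1_def K2_def K3_def D_def algebra_simps)
  have nz2: "F \<noteq> 0" "H \<noteq> 0" "K \<noteq> 0" "W \<noteq> 0" by (simp_all add: F_def H_def K_def W_def)
  have nz3: "N1 \<noteq> 0" "N2 \<noteq> 0" "K1 \<noteq> 0" "K2 \<noteq> 0" "K3 \<noteq> 0" "D \<noteq> 0"
    unfolding N1_def N2_def K1_def K2_def K3_def D_def of_nat_eq_0_iff by auto
  have A: "coeff_A (Suc n) (Suc k) \<nu> = 2 * N2 * (N1 * F) * onum \<nu> (Suc k) * y2
     / (4 * W * (2 * K2 * (K1 * H)) * (D * K) * (z1 * (Y * z2)))"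
    using coeff_A_generic[of "Suc k" "Suc n" \<nu>] y(2) k
    unfolding po3 e f by (simp add: y2_def add_ac del: fact_Suc prod.lessThan_Suc of_nat_Suc)
  have B1: "coeff_B n (Suc k) \<nu> = N1 * F * onum \<nu> (Suc k) * y3
     / (W * (K3 * (2 * K2 * (K1 * H))) * K * (Y * z2))"
    using coeff_B_generic[of "Suc k" n \<nu>] y(3) k
    unfolding po2 e f K_def[symmetric] by (simp add: y3_def eval_nat_numeral add_ac del: fact_Suc prod.lessThan_Suc)
  have B0: "coeff_B n k \<nu> = N1 * F * onum \<nu> k * y1
     / (2 * W * (K1 * H) * (D * K) * (z1 * Y))"
    using coeff_B_generic[of k n \<nu>] y(1) k
    unfolding po1 e f by (simp add: y1_def del: fact_Suc prod.lessThan_Suc)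
  define Z where "Z = 2 * \<nu> + of_nat (2 * k + 1)"
  have on: "onum \<nu> (Suc k) = onum \<nu> k * Z" by (simp add: Z_def)
  \<comment> \<open>Division by \<open>K2 * D * z1 * z2\<close> splits this into the two partial
    fractions that match the two neighbouring sites.\<close>
  have main: "N2 * y2 = D * z1 + K2 * z2"
    by (simp add: N2_def D_def K2_def y2_def z1_def z2_def d algebra_simps)
  define U where "U = N1 * F * onum \<nu> k * Z / (4 * W * K1 * H * K)"
  have "coeff_A (Suc n) (Suc k) \<nu> = U * (N2 * y2) / (K2 * D * z1 * Y * z2)"
    using nz2 nz3 unfolding A on U_def by (simp add: mult_ac)
  also have "\<dots> = U / (K2 * Y * z2) + U / (D * z1 * Y)"
    using nz3 y Y unfolding main by (simp add: divide_simps) (simp add: algebra_simps)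
  also have "U / (K2 * Y * z2) = K3 / (2 * y3) * coeff_B n (Suc k) \<nu>"
    using nz2 nz3 y Y unfolding B1 U_def on by (simp add: divide_simps)
  also have "U / (D * z1 * Y) = Z / (2 * y1) * coeff_B n k \<nu>"
    using nz2 nz3 y Y unfolding B0 U_def by (simp add: divide_simps)
  finally show ?thesis unfolding r1 r2 K3_def Z_def .
qed

section \<open>Closed form of the path weights\<close>

lemma dcoeff_odd_step:
  assumes ev: "\<And>k. k \<le> n \<Longrightarrow> dcoeff a b \<nu> (2 * n) (2 * k) = a ^ (n - k) * b ^ (n + k) * coeff_A n k \<nu>"
    and nz: "\<And>i. 1 \<le> i \<Longrightarrow> i \<le> 2 * n \<Longrightarrow> \<nu> + of_nat i \<noteq> 0" and k: "k \<le> n"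
  shows "dcoeff a b \<nu> (2 * n + 1) (2 * k + 1) = a ^ (n - k) * b ^ (n + k + 1) * coeff_B n k \<nu>"
proof (cases "k = n")
  case True
  \<comment> \<open>The upper neighbour 2n+2 is out of reach after 2n steps, so only the step up
    from 2n contributes.\<close>
  have "dcoeff a b \<nu> (2 * n) (Suc (Suc (2 * n))) = 0" by (rule dcoeff_eq_0) simp
  then show ?thesis using True ev[OF k] coeff_B_rec_last[OF nz] by (simp add: mult_ac)
next
  case False
  with k have k: "k < n" by simp
  have "n - k = Suc (n - Suc k)" using k by simp
  then show ?thesis using ev[of "Suc k"] ev[of k] k coeff_B_rec[OF nz k]
    by (simp add: algebra_simps)
qed

lemma dcoeff_even_step:
  assumes od: "\<And>k. k \<le> n \<Longrightarrow>
      dcoeff a b \<nu> (2 * n + 1) (2 * k + 1) = a ^ (n - k) * b ^ (n + k + 1) * coeff_B n k \<nu>"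
    and nz: "\<And>i. 1 \<le> i \<Longrightarrow> i \<le> 2 * n + 1 \<Longrightarrow> \<nu> + of_nat i \<noteq> 0" and k: "k \<le> Suc n"
  shows "dcoeff a b \<nu> (2 * Suc n) (2 * k) = a ^ (Suc n - k) * b ^ (Suc n + k) * coeff_A (Suc n) k \<nu>"
proof (cases k)
  case 0
  have "dcoeff a b \<nu> (2 * Suc n) 0 = a * ((1 - ratio \<nu> 1) / 2) * dcoeff a b \<nu> (2 * n + 1) 1"
    using dcoeff.simps(2)[of a b \<nu> "2 * n + 1" 0] by (simp del: dcoeff.simps)
  moreover have "\<nu> + 1 \<noteq> 0" using nz[of 1] by simp
  ultimately show ?thesis using od[of 0]
    by (simp add: 0 coeff_A_rec_0 del: dcoeff.simps)
next
  case (Suc j)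
  have rec: "dcoeff a b \<nu> (2 * Suc n) (2 * k)
     = a * ((1 - ratio \<nu> (2 * j + 3)) / 2) * dcoeff a b \<nu> (2 * n + 1) (2 * j + 3)
       + b * ((1 + ratio \<nu> (2 * j + 1)) / 2) * dcoeff a b \<nu> (2 * n + 1) (2 * j + 1)"
    using dcoeff.simps(2)[of a b \<nu> "2 * n + 1" "2 * j + 2"] Suc
    by (simp add: eval_nat_numeral del: dcoeff.simps)
  show ?thesis
  proof (cases "j = n")
    case True
    have "dcoeff a b \<nu> (2 * n + 1) (2 * n + 3) = 0" by (rule dcoeff_eq_0) simp
    then show ?thesis unfolding rec using Suc True od[of n] coeff_A_rec_last[of \<nu> n] nz[of "2 * n + 1"]
      by (simp add: mult_ac del: dcoeff.simps of_nat_Suc)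
  next
    case False
    with Suc k have j: "j < n" by simp
    have e: "n - j = Suc (n - Suc j)" using j by simp
    have "dcoeff a b \<nu> (2 * n + 1) (2 * j + 3)
        = a ^ (n - Suc j) * b ^ (n + Suc j + 1) * coeff_B n (Suc j) \<nu>"
      using od[of "Suc j"] j by (simp add: eval_nat_numeral del: dcoeff.simps)
    moreover have "dcoeff a b \<nu> (2 * n + 1) (2 * j + 1)
        = a * a ^ (n - Suc j) * b ^ (n + j + 1) * coeff_B n j \<nu>"
      using od[of j] j e by (simp del: dcoeff.simps)
    moreover have "a ^ (Suc n - k) = a * a ^ (n - Suc j)" using e Suc by simp
    moreover have "coeff_A (Suc n) k \<nu> = (1 - ratio \<nu> (2 * j + 3)) / 2 * coeff_B n (Suc j) \<nu>
        + (1 + ratio \<nu> (2 * j + 1)) / 2 * coeff_B n j \<nu>"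
      unfolding Suc by (rule coeff_A_rec) (use nz j in auto)
    moreover have "b ^ (Suc n + k) = b * b ^ (n + j + 1)" "b ^ (n + Suc j + 1) = b * b ^ (n + j + 1)"
      by (simp_all add: Suc)
    ultimately show ?thesis unfolding rec by (simp only: distrib_left mult_ac)
  qed
qed

text \<open>A path of 2n steps from 0 to 2k has n-k steps down and n+k steps up, whatever its shape,
  so the powers of \<open>a\<close> and \<open>b\<close> factor out; an odd path to 2k+1 has one
  more step up. The half-open ranges omit the last site, from which no step departs.\<close>

lemma dcoeff_closed_form:
  "((\<forall>i\<in>{1..<2 * n}. \<nu> + of_nat i \<noteq> 0) \<longrightarrow> (\<forall>k\<le>n.
      dcoeff a b \<nu> (2 * n) (2 * k) = a ^ (n - k) * b ^ (n + k) * coeff_A n k \<nu>)) \<and>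
   ((\<forall>i\<in>{1..<2 * n + 1}. \<nu> + of_nat i \<noteq> 0) \<longrightarrow> (\<forall>k\<le>n.
      dcoeff a b \<nu> (2 * n + 1) (2 * k + 1) = a ^ (n - k) * b ^ (n + k + 1) * coeff_B n k \<nu>))"
  (is "?E n \<and> ?O n")
proof -
  \<comment> \<open>The odd case follows from the even case at the same n, so the induction only has
    to carry the even one.\<close>
  have EO: "?O n" if E: "?E n" for n
  proof (intro impI allI)
    fix k assume nz: "\<forall>i\<in>{1..<2 * n + 1}. \<nu> + of_nat i \<noteq> 0" and k: "k \<le> n"
    show "dcoeff a b \<nu> (2 * n + 1) (2 * k + 1) = a ^ (n - k) * b ^ (n + k + 1) * coeff_B n k \<nu>"
      by (rule dcoeff_odd_step) (use nz k E in auto)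
  qed
  have "?E n"
  proof (induction n)
    case 0
    then show ?case by (simp add: coeff_A_def)
  next
    case (Suc n)
    show ?case
    proof (intro impI allI)
      fix k assume nz: "\<forall>i\<in>{1..<2 * Suc n}. \<nu> + of_nat i \<noteq> 0" and k: "k \<le> Suc n"
      have "\<forall>i\<in>{1..<2 * n + 1}. \<nu> + of_nat i \<noteq> 0" using nz by auto
      then have od: "\<forall>k\<le>n. dcoeff a b \<nu> (2 * n + 1) (2 * k + 1)
          = a ^ (n - k) * b ^ (n + k + 1) * coeff_B n k \<nu>"
        using EO[OF Suc.IH] by blast
      show "dcoeff a b \<nu> (2 * Suc n) (2 * k)
          = a ^ (Suc n - k) * b ^ (Suc n + k) * coeff_A (Suc n) k \<nu>"
        by (rule dcoeff_even_step) (use nz k od in auto)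
    qed
  qed
  with EO show ?thesis by blast
qed

section \<open>Powers for a branch of the logarithm\<close>

lemma log_branchD:
  assumes "log_branch_on S lg"
  shows "open S" and "z \<in> S \<Longrightarrow> exp (lg z) = z" and "z \<in> S \<Longrightarrow> z \<noteq> 0"
  using assms exp_not_eq_zero[of "lg z"] by (auto simp: log_branch_on_def simp del: exp_not_eq_zero)

lemma cpow_nonzero [simp]: "cpow lg z a \<noteq> 0"
  by (simp add: cpow_def)

lemma cpow_add: "cpow lg z (a + b) = cpow lg z a * cpow lg z b"
  by (simp add: cpow_def distrib_right exp_add)

lemma cpow_minus: "cpow lg z (- a) = 1 / cpow lg z a"
  by (simp add: cpow_def exp_minus field_simps)

lemma cpow_diff: "cpow lg z (a - b) = cpow lg z a / cpow lg z b"
  by (simp add: cpow_def left_diff_distrib exp_diff)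

lemma cpow_of_nat: "exp (lg z) = z \<Longrightarrow> cpow lg z (of_nat n) = z ^ n"
  by (simp add: cpow_def exp_of_nat_mult)

lemma cpow_1: "exp (lg z) = z \<Longrightarrow> cpow lg z 1 = z"
  by (simp add: cpow_def)

text \<open>A branch is only assumed continuous. Being a local right inverse of exp, whose
  derivative at \<open>lg z\<close> is z \<noteq> 0, it is differentiable with derivative
  1/z.\<close>

lemma has_field_derivative_cpow:
  assumes "log_branch_on S lg" "z \<in> S"
  shows "((\<lambda>x. cpow lg x a) has_field_derivative a * cpow lg z (a - 1)) (at z)"
proof -
  have S: "open S" "\<And>z. z \<in> S \<Longrightarrow> exp (lg z) = z" "continuous_on S lg"
    using assms by (auto simp: log_branch_on_def)
  have lg: "(lg has_field_derivative inverse z) (at z)"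
  proof (rule has_field_derivative_inverse_basic)
    show "(exp has_field_derivative z) (at (lg z))"
      using DERIV_exp[of "lg z"] S(2)[OF assms(2)] by simp
    show "continuous (at z) lg" using S assms continuous_on_eq_continuous_at by blast
  qed (use S assms log_branchD in auto)
  have "((\<lambda>x. cpow lg x a) has_field_derivative a * (cpow lg z a * inverse z)) (at z)"
    unfolding cpow_def by (rule derivative_eq_intros lg refl)+ simp
  then show ?thesis
    using S(2)[OF assms(2)] by (simp add: cpow_diff cpow_1 field_simps)
qed

text \<open>The shape with a constant \<open>c\<close> is that of t, u, v and w, so this one rule
  gives the passage from m to m + 1 for all of them.\<close>

lemma has_field_derivative_desc_fact_cpow:
  assumes "log_branch_on S lg" "z \<in> S"
  shows "((\<lambda>x. c * desc_fact e m * cpow lg x (e - of_nat m)) has_field_derivative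
    c * desc_fact e (Suc m) * cpow lg z (e - of_nat (Suc m))) (at z)"
proof -
  have e: "e - of_nat (Suc m) = e - of_nat m - 1" by simp
  have "c * desc_fact e m * ((e - of_nat m) * cpow lg z (e - of_nat m - 1))
      = c * desc_fact e (Suc m) * cpow lg z (e - of_nat (Suc m))"
    unfolding e by (simp add: desc_fact_def)
  with DERIV_cmult[OF has_field_derivative_cpow[OF assms, of "e - of_nat m"], of "c * desc_fact e m"]
  show ?thesis by (simp only:)
qed

section \<open>Iterated derivatives\<close>

lemma sum_lessThan_2n:
  fixes f :: "nat \<Rightarrow> complex"
  shows "(\<Sum>i<2 * n. f i) = (\<Sum>j<n. f (2 * j)) + (\<Sum>j<n. f (2 * j + 1))"
  by (induction n) (simp_all add: algebra_simps)

lemma sum_atMost_even: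
  fixes f :: "nat \<Rightarrow> complex"
  assumes "\<And>l. odd l \<Longrightarrow> f l = 0"
  shows "(\<Sum>l\<le>2 * n. f l) = (\<Sum>k\<le>n. f (2 * k))"
  by (induction n) (simp_all add: assms)

lemma sum_atMost_odd:
  fixes f :: "nat \<Rightarrow> complex"
  assumes "\<And>l. even l \<Longrightarrow> f l = 0"
  shows "(\<Sum>l\<le>2 * n + 1. f l) = (\<Sum>k\<le>n. f (2 * k + 1))"
  by (induction n) (simp_all add: assms)

text \<open>Differentiation distributes each site to its neighbours, whereas \<open>dcoeff\<close>
  collects from them; the two descriptions agree after shifting indices.\<close>

lemma dcoeff_Suc_sum:
  "(\<Sum>l\<le>N. dcoeff a b \<nu> N l * (a * ((1 - ratio \<nu> l) / 2) * g (l - 1)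
       + b * ((1 + ratio \<nu> l) / 2) * g (l + 1)))
     = (\<Sum>l\<le>Suc N. dcoeff a b \<nu> (Suc N) l * g l)"
proof -
  define u where "u l = a * ((1 - ratio \<nu> l) / 2) * dcoeff a b \<nu> N l" for l
  define w where "w l = b * ((1 + ratio \<nu> l) / 2) * dcoeff a b \<nu> N l" for l
  \<comment> \<open>The weight at 0 vanishes because the ratio there is 1, which makes the truncated
    index \<open>l - 1\<close> harmless; sites above N carry no weight.\<close>
  have u0: "u 0 = 0" and uN: "u (Suc N) = 0" "u (Suc (Suc N)) = 0"
    by (simp_all add: u_def dcoeff_eq_0)
  have "(\<Sum>l\<le>Suc N. dcoeff a b \<nu> (Suc N) l * g l)
      = (\<Sum>l\<le>Suc N. u (Suc l) * g l + (case l of 0 \<Rightarrow> 0 | Suc l' \<Rightarrow> w l') * g l)"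
    by (intro sum.cong) (auto simp: u_def w_def distrib_right split: nat.splits)
  also have "\<dots> = (\<Sum>l\<le>Suc N. u (Suc l) * g l) + (\<Sum>l\<le>N. w l * g (Suc l))"
    unfolding sum.distrib by (subst (2) sum.atMost_Suc_shift) simp
  also have "(\<Sum>l\<le>Suc N. u (Suc l) * g l) = (\<Sum>l\<le>N. u (Suc l) * g l)"
    using uN by simp
  also have "\<dots> = (\<Sum>l\<le>Suc N. u l * g (l - 1))"
    by (subst sum.atMost_Suc_shift) (simp add: u0)
  also have "\<dots> = (\<Sum>l\<le>N. u l * g (l - 1))"
    using uN by simp
  finally show ?thesis
    by (simp add: sum.distrib[symmetric] u_def w_def algebra_simps)
qed

text \<open>The derivative rule for \<open>g l\<close> is required only for l < N because the site N
  first appears in the N-th derivative and is not differentiated again. This keeps \<nu> = -N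
  admissible.\<close>

lemma higher_deriv_recurrence:
  assumes S: "open S" "z \<in> S"
    and g: "\<And>l x. l < N \<Longrightarrow> x \<in> S \<Longrightarrow> (g l has_field_derivative
        a * ((1 - ratio \<nu> l) / 2) * g (l - 1) x + b * ((1 + ratio \<nu> l) / 2) * g (l + 1) x + p l 0 x) (at x)"
    and p: "\<And>l m x. x \<in> S \<Longrightarrow> (p l m has_field_derivative p l (Suc m) x) (at x)"
  shows "(deriv ^^ N) (g 0) z = (\<Sum>l\<le>N. dcoeff a b \<nu> N l * g l z)
     + (\<Sum>i<N. \<Sum>l\<le>i. dcoeff a b \<nu> i l * p l (N - 1 - i) z)"
  using \<open>z \<in> S\<close> g
proof (induction N arbitrary: z)
  case 0
  then show ?case by simp
next
  case (Suc N)
  let ?F = "\<lambda>x. (\<Sum>l\<le>N. dcoeff a b \<nu> N l * g l x)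
     + (\<Sum>i<N. \<Sum>l\<le>i. dcoeff a b \<nu> i l * p l (N - 1 - i) x)"
  let ?G = "\<lambda>l x. a * ((1 - ratio \<nu> l) / 2) * g (l - 1) x + b * ((1 + ratio \<nu> l) / 2) * g (l + 1) x + p l 0 x"
  have eq: "(deriv ^^ N) (g 0) x = ?F x" if "x \<in> S" for x
    using Suc.IH[OF that] Suc.prems(2) by simp
  \<comment> \<open>The formula for N holds throughout the open set \<open>S\<close>, hence near z,
    and can therefore be differentiated at z.\<close>
  have ev: "eventually (\<lambda>x. (deriv ^^ N) (g 0) x = ?F x) (nhds z)"
    using eventually_nhds_in_open[OF S(1) Suc.prems(1)] by (rule eventually_mono) (rule eq)
  have "(?F has_field_derivative (\<Sum>l\<le>N. dcoeff a b \<nu> N l * ?G l z)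
     + (\<Sum>i<N. \<Sum>l\<le>i. dcoeff a b \<nu> i l * p l (Suc (N - 1 - i)) z)) (at z)"
    by (intro DERIV_add DERIV_sum DERIV_cmult Suc.prems p) auto
  then have "deriv ?F z = (\<Sum>l\<le>N. dcoeff a b \<nu> N l * ?G l z)
     + (\<Sum>i<N. \<Sum>l\<le>i. dcoeff a b \<nu> i l * p l (Suc (N - 1 - i)) z)"
    by (rule DERIV_imp_deriv)
  also have "(\<Sum>l\<le>N. dcoeff a b \<nu> N l * ?G l z) = (\<Sum>l\<le>Suc N. dcoeff a b \<nu> (Suc N) l * g l z)
      + (\<Sum>l\<le>N. dcoeff a b \<nu> N l * p l 0 z)"
    unfolding dcoeff_Suc_sum[symmetric] sum.distrib[symmetric] by (simp only: distrib_left)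
  also have "(\<Sum>i<N. \<Sum>l\<le>i. dcoeff a b \<nu> i l * p l (Suc (N - 1 - i)) z)
      = (\<Sum>i<N. \<Sum>l\<le>i. dcoeff a b \<nu> i l * p l (Suc N - 1 - i) z)"
    by (intro sum.cong refl) (simp add: Suc_diff_Suc)
  finally have "deriv ?F z = (\<Sum>l\<le>Suc N. dcoeff a b \<nu> (Suc N) l * g l z)
      + (\<Sum>i<Suc N. \<Sum>l\<le>i. dcoeff a b \<nu> i l * p l (Suc N - 1 - i) z)"
    by (simp del: dcoeff.simps)
  then show ?case
    using deriv_cong_ev[OF ev refl] by (simp del: dcoeff.simps)
qed

text \<open>Parity leaves only even sites after an even number of steps and odd sites after an odd
  number. Splitting the double sum by the parity of i thus separates the A terms from the B
  terms.\<close>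

lemma higher_deriv_even_odd:
  assumes S: "open S" "z \<in> S"
    and g: "\<And>l x. l = 0 \<or> \<nu> + of_nat l \<noteq> 0 \<Longrightarrow> x \<in> S \<Longrightarrow> (g l has_field_derivative
        a * ((1 - ratio \<nu> l) / 2) * g (l - 1) x + b * ((1 + ratio \<nu> l) / 2) * g (l + 1) x + p l 0 x) (at x)"
    and p: "\<And>l m x. x \<in> S \<Longrightarrow> (p l m has_field_derivative p l (Suc m) x) (at x)"
  shows "\<nu> \<notin> (\<lambda>i. - of_nat i) ` {1..2 * n - 1} \<Longrightarrow>
     (deriv ^^ (2 * n)) (g 0) z
       = (\<Sum>k\<le>n. a ^ (n - k) * b ^ (n + k) * coeff_A n k \<nu> * g (2 * k) z)
       + (\<Sum>j<n. \<Sum>k\<le>j. a ^ (j - k) * b ^ (j + k) * coeff_A j k \<nu> * p (2 * k) (2 * n - 2 * j - 1) z)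
       + (\<Sum>j<n. \<Sum>k\<le>j. a ^ (j - k) * b ^ (j + k + 1) * coeff_B j k \<nu> * p (2 * k + 1) (2 * n - 2 * j - 2) z)"
    (is "?E \<Longrightarrow> ?P1")
    and "\<nu> \<notin> (\<lambda>i. - of_nat i) ` {1..2 * n} \<Longrightarrow>
     (deriv ^^ (2 * n + 1)) (g 0) z
       = (\<Sum>k\<le>n. a ^ (n - k) * b ^ (n + k + 1) * coeff_B n k \<nu> * g (2 * k + 1) z)
       + (\<Sum>j<n + 1. \<Sum>k\<le>j. a ^ (j - k) * b ^ (j + k) * coeff_A j k \<nu> * p (2 * k) (2 * n - 2 * j) z)
       + (\<Sum>j<n. \<Sum>k\<le>j. a ^ (j - k) * b ^ (j + k + 1) * coeff_B j k \<nu> * p (2 * k + 1) (2 * n - 2 * j - 1) z)"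
    (is "?O \<Longrightarrow> ?P2")
proof -
  have even: "(\<Sum>l\<le>2 * j. dcoeff a b \<nu> (2 * j) l * f l)
      = (\<Sum>k\<le>j. a ^ (j - k) * b ^ (j + k) * coeff_A j k \<nu> * f (2 * k))"
    if "\<forall>i\<in>{1..<2 * j}. \<nu> + of_nat i \<noteq> 0" for j f
  proof -
    have "(\<Sum>l\<le>2 * j. dcoeff a b \<nu> (2 * j) l * f l) = (\<Sum>k\<le>j. dcoeff a b \<nu> (2 * j) (2 * k) * f (2 * k))"
      by (rule sum_atMost_even) (simp add: dcoeff_parity)
    also have "\<dots> = (\<Sum>k\<le>j. a ^ (j - k) * b ^ (j + k) * coeff_A j k \<nu> * f (2 * k))"
      using dcoeff_closed_form[of j \<nu> a b] that by (intro sum.cong) auto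
    finally show ?thesis .
  qed
  have odd: "(\<Sum>l\<le>2 * j + 1. dcoeff a b \<nu> (2 * j + 1) l * f l)
      = (\<Sum>k\<le>j. a ^ (j - k) * b ^ (j + k + 1) * coeff_B j k \<nu> * f (2 * k + 1))"
    if "\<forall>i\<in>{1..<2 * j + 1}. \<nu> + of_nat i \<noteq> 0" for j f
  proof -
    have "(\<Sum>l\<le>2 * j + 1. dcoeff a b \<nu> (2 * j + 1) l * f l)
        = (\<Sum>k\<le>j. dcoeff a b \<nu> (2 * j + 1) (2 * k + 1) * f (2 * k + 1))"
      by (rule sum_atMost_odd) (simp add: dcoeff_parity del: dcoeff.simps)
    also have "\<dots> = (\<Sum>k\<le>j. a ^ (j - k) * b ^ (j + k + 1) * coeff_B j k \<nu> * f (2 * k + 1))"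
      using dcoeff_closed_form[of j \<nu> a b] that by (intro sum.cong) (auto simp del: dcoeff.simps)
    finally show ?thesis .
  qed
  \<comment> \<open>The bound \<open>M \<le> N + 1\<close> holds for M = 2n and N = 2n-1 also when n
    = 0, where the subtraction is truncated.\<close>
  have sub: "\<forall>i\<in>{1..<M}. \<nu> + of_nat i \<noteq> 0" if "\<nu> \<notin> (\<lambda>i. - of_nat i) ` {1..N}" "M \<le> N + 1" for M N :: nat
  proof (intro ballI notI)
    fix i assume "i \<in> {1..<M}" "\<nu> + of_nat i = 0"
    then have "\<nu> = - of_nat i" "i \<in> {1..N}" using that(2) by (auto simp: eq_neg_iff_add_eq_0)
    with that(1) show False by blast
  qed
  have deriv: "(deriv ^^ M) (g 0) z = (\<Sum>l\<le>M. dcoeff a b \<nu> M l * g l z)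
     + (\<Sum>i<M. \<Sum>l\<le>i. dcoeff a b \<nu> i l * p l (M - 1 - i) z)"
    if "\<forall>i\<in>{1..<M}. \<nu> + of_nat i \<noteq> 0" for M
  proof (rule higher_deriv_recurrence[OF S])
    fix l x assume "l < M" "x \<in> S"
    with that have "l = 0 \<or> \<nu> + of_nat l \<noteq> 0" by (cases "l = 0") auto
    with \<open>x \<in> S\<close> show "(g l has_field_derivative a * ((1 - ratio \<nu> l) / 2) * g (l - 1) x
        + b * ((1 + ratio \<nu> l) / 2) * g (l + 1) x + p l 0 x) (at x)"
      by (rule g[rotated])
  qed (rule p)
  {
    assume ?E
    note nz = sub[OF this]
    have "\<forall>i\<in>{1..<2 * n}. \<nu> + of_nat i \<noteq> 0" by (rule nz) simp
    note d = deriv[OF this] even[OF this, of "\<lambda>l. g l z"]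
    have "(\<Sum>j<n. \<Sum>l\<le>2 * j. dcoeff a b \<nu> (2 * j) l * p l (2 * n - 1 - 2 * j) z)
       = (\<Sum>j<n. \<Sum>k\<le>j. a ^ (j - k) * b ^ (j + k) * coeff_A j k \<nu> * p (2 * k) (2 * n - 2 * j - 1) z)"
    proof (rule sum.cong[OF refl])
      fix j assume "j \<in> {..<n}"
      then have "\<forall>i\<in>{1..<2 * j}. \<nu> + of_nat i \<noteq> 0" by (intro nz) auto
      note even[OF this, of "\<lambda>l. p l (2 * n - 1 - 2 * j) z"]
      moreover have "2 * n - 1 - 2 * j = 2 * n - 2 * j - 1" by simp
      ultimately show "(\<Sum>l\<le>2 * j. dcoeff a b \<nu> (2 * j) l * p l (2 * n - 1 - 2 * j) z)
       = (\<Sum>k\<le>j. a ^ (j - k) * b ^ (j + k) * coeff_A j k \<nu> * p (2 * k) (2 * n - 2 * j - 1) z)"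
        by (simp only:)
    qed
    moreover have "(\<Sum>j<n. \<Sum>l\<le>2 * j + 1. dcoeff a b \<nu> (2 * j + 1) l * p l (2 * n - 1 - (2 * j + 1)) z)
       = (\<Sum>j<n. \<Sum>k\<le>j. a ^ (j - k) * b ^ (j + k + 1) * coeff_B j k \<nu> * p (2 * k + 1) (2 * n - 2 * j - 2) z)"
    proof (rule sum.cong[OF refl])
      fix j assume "j \<in> {..<n}"
      then have "\<forall>i\<in>{1..<2 * j + 1}. \<nu> + of_nat i \<noteq> 0" by (intro nz) auto
      note odd[OF this, of "\<lambda>l. p l (2 * n - 1 - (2 * j + 1)) z"]
      moreover have "2 * n - 1 - (2 * j + 1) = 2 * n - 2 * j - 2" by simp
      ultimately show "(\<Sum>l\<le>2 * j + 1. dcoeff a b \<nu> (2 * j + 1) l * p l (2 * n - 1 - (2 * j + 1)) z)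
       = (\<Sum>k\<le>j. a ^ (j - k) * b ^ (j + k + 1) * coeff_B j k \<nu> * p (2 * k + 1) (2 * n - 2 * j - 2) z)"
        by (simp only:)
    qed
    ultimately show ?P1
      unfolding d sum_lessThan_2n by (simp only: add.assoc)
  }
  {
    assume ?O
    note nz = sub[OF this]
    have "\<forall>i\<in>{1..<2 * n + 1}. \<nu> + of_nat i \<noteq> 0" by (rule nz) simp
    note d = deriv[OF this] odd[OF this, of "\<lambda>l. g l z"]
    have "(\<Sum>j<n + 1. \<Sum>l\<le>2 * j. dcoeff a b \<nu> (2 * j) l * p l (2 * n - 2 * j) z)
       = (\<Sum>j<n + 1. \<Sum>k\<le>j. a ^ (j - k) * b ^ (j + k) * coeff_A j k \<nu> * p (2 * k) (2 * n - 2 * j) z)"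
    proof (rule sum.cong[OF refl])
      fix j assume "j \<in> {..<n + 1}"
      then have "\<forall>i\<in>{1..<2 * j}. \<nu> + of_nat i \<noteq> 0" by (intro nz) auto
      from even[OF this, of "\<lambda>l. p l (2 * n - 2 * j) z"]
      show "(\<Sum>l\<le>2 * j. dcoeff a b \<nu> (2 * j) l * p l (2 * n - 2 * j) z)
       = (\<Sum>k\<le>j. a ^ (j - k) * b ^ (j + k) * coeff_A j k \<nu> * p (2 * k) (2 * n - 2 * j) z)" .
    qed
    moreover have "(\<Sum>j<n. \<Sum>l\<le>2 * j + 1. dcoeff a b \<nu> (2 * j + 1) l * p l (2 * n - (2 * j + 1)) z)
       = (\<Sum>j<n. \<Sum>k\<le>j. a ^ (j - k) * b ^ (j + k + 1) * coeff_B j k \<nu> * p (2 * k + 1) (2 * n - 2 * j - 1) z)"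
    proof (rule sum.cong[OF refl])
      fix j assume "j \<in> {..<n}"
      then have "\<forall>i\<in>{1..<2 * j + 1}. \<nu> + of_nat i \<noteq> 0" by (intro nz) auto
      note odd[OF this, of "\<lambda>l. p l (2 * n - (2 * j + 1)) z"]
      moreover have "2 * n - (2 * j + 1) = 2 * n - 2 * j - 1" by simp
      ultimately show "(\<Sum>l\<le>2 * j + 1. dcoeff a b \<nu> (2 * j + 1) l * p l (2 * n - (2 * j + 1)) z)
       = (\<Sum>k\<le>j. a ^ (j - k) * b ^ (j + k + 1) * coeff_B j k \<nu> * p (2 * k + 1) (2 * n - 2 * j - 1) z)"
        by (simp only:)
    qed
    \<comment> \<open>An odd number of summands ends with the even index 2n, so the A sum has one
      more term than the B sum.\<close>
    moreover have "(\<Sum>i<2 * n + 1. f i) = (\<Sum>j<n + 1. f (2 * j)) + (\<Sum>j<n. f (2 * j + 1))"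
      for f :: "nat \<Rightarrow> complex"
      using sum_lessThan_2n[of f n] by simp
    ultimately show ?P2
      unfolding d by (simp only: add.assoc diff_add_inverse2)
  }
qed

text \<open>\<open>p\<close> and \<open>q\<close> are the inhomogeneities of the recurrences for the
  derivative and for \<mu> G / x. Elimination leaves (r q - p)/2 for quotients and -(r q + p)/2 for
  products. With q = -p, as for Struve functions, the factors 1 + r and 1 - r of t and u appear;
  with p = 0, as for Anger and Weber functions, only r survives, which is the factor \<nu>/(\<nu>
  \<plusminus> l) of v and w.\<close>

locale struve_type_recurrence =
  fixes S :: "complex set" and lg :: "complex \<Rightarrow> complex" and \<sigma> :: complex
    and G D p q :: "complex \<Rightarrow> complex \<Rightarrow> complex"
    and P Q :: "complex \<Rightarrow> nat \<Rightarrow> nat \<Rightarrow> complex \<Rightarrow> complex"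
  assumes branch: "log_branch_on S lg"
    and sign: "\<sigma> = 1 \<or> \<sigma> = -1"
    and deriv_G: "x \<in> S \<Longrightarrow> (G \<mu> has_field_derivative D \<mu> x) (at x)"
    and rec_D: "x \<in> S \<Longrightarrow> G (\<mu> - 1) x + \<sigma> * G (\<mu> + 1) x = 2 * D \<mu> x + p \<mu> x"
    and rec_G: "x \<in> S \<Longrightarrow> G (\<mu> - 1) x - \<sigma> * G (\<mu> + 1) x = 2 * \<mu> / x * G \<mu> x + q \<mu> x"
    and P_0: "x \<in> S \<Longrightarrow> l = 0 \<or> \<nu> + of_nat l \<noteq> 0 \<Longrightarrow>
       P \<nu> l 0 x = (ratio \<nu> l * q (\<nu> + of_nat l) x - p (\<nu> + of_nat l) x) / (2 * cpow lg x \<nu>)"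
    and Q_0: "x \<in> S \<Longrightarrow> l = 0 \<or> - \<nu> + of_nat l \<noteq> 0 \<Longrightarrow>
       Q \<nu> l 0 x = - (ratio (- \<nu>) l * q (\<nu> - of_nat l) x + p (\<nu> - of_nat l) x) * cpow lg x \<nu> / 2"
    and deriv_P: "x \<in> S \<Longrightarrow> (P \<nu> l m has_field_derivative P \<nu> l (Suc m) x) (at x)"
    and deriv_Q: "x \<in> S \<Longrightarrow> (Q \<nu> l m has_field_derivative Q \<nu> l (Suc m) x) (at x)"
begin

lemma deriv_quotient:
  assumes x: "x \<in> S" and l: "l = 0 \<or> \<nu> + of_nat l \<noteq> 0"
  shows "((\<lambda>x. G (\<nu> + of_nat l) x / cpow lg x \<nu>) has_field_derivative
     1 * ((1 - ratio \<nu> l) / 2) * (G (\<nu> + of_nat (l - 1)) x / cpow lg x \<nu>)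
     + \<sigma> * ((1 + ratio \<nu> l) / 2) * (G (\<nu> + of_nat (l + 1)) x / cpow lg x \<nu>) + P \<nu> l 0 x) (at x)"
proof -
  define \<mu> where "\<mu> = \<nu> + of_nat l"
  define r where "r = ratio \<nu> l"
  \<comment> \<open>This turns the term with \<nu> / x, which comes from the power, into r times
    \<mu> / x * G \<mu> x, to which \<open>rec_G\<close> applies.\<close>
  have r: "r * \<mu> = \<nu>" using ratio_times[OF l] by (simp add: r_def \<mu>_def)
  have x0: "x \<noteq> 0" "exp (lg x) = x" using log_branchD[OF branch] x by auto
  define c where "c = cpow lg x \<nu>"
  have c0: "c \<noteq> 0" by (simp add: c_def)
  have "((\<lambda>x. G \<mu> x / cpow lg x \<nu>) has_field_derivative
      (D \<mu> x * c - G \<mu> x * (\<nu> * cpow lg x (\<nu> - 1))) / (c * c)) (at x)"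
    unfolding c_def by (intro DERIV_divide deriv_G has_field_derivative_cpow[OF branch] x) simp
  also have "cpow lg x (\<nu> - 1) = c / x" using x0 by (simp add: cpow_diff cpow_1 c_def)
  also have "(D \<mu> x * c - G \<mu> x * (\<nu> * (c / x))) / (c * c) = (D \<mu> x - r * (\<mu> / x * G \<mu> x)) / c"
    using c0 x0 unfolding r[symmetric] by (simp add: field_simps)
  also have "\<mu> / x * G \<mu> x = (G (\<mu> - 1) x - \<sigma> * G (\<mu> + 1) x - q \<mu> x) / 2"
    using rec_G[OF x, of \<mu>] by (simp add: field_simps)
  also have "D \<mu> x = (G (\<mu> - 1) x + \<sigma> * G (\<mu> + 1) x - p \<mu> x) / 2"
    using rec_D[OF x, of \<mu>] by (simp add: field_simps)
  also have "((G (\<mu> - 1) x + \<sigma> * G (\<mu> + 1) x - p \<mu> x) / 2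
        - r * ((G (\<mu> - 1) x - \<sigma> * G (\<mu> + 1) x - q \<mu> x) / 2)) / c
     = (1 - r) / 2 * (G (\<mu> - 1) x / c) + \<sigma> * ((1 + r) / 2) * (G (\<mu> + 1) x / c)
        + (r * q \<mu> x - p \<mu> x) / (2 * c)"
    using c0 by (simp add: divide_simps) (simp add: algebra_simps)
  \<comment> \<open>At l = 0 the indices on the two sides differ, but both terms vanish since r =
    1.\<close>
  also have "(1 - r) / 2 * (G (\<mu> - 1) x / c) = 1 * ((1 - r) / 2) * (G (\<nu> + of_nat (l - 1)) x / c)"
  proof (cases "l = 0")
    case False
    then have "\<mu> - 1 = \<nu> + of_nat (l - 1)" by (simp add: \<mu>_def of_nat_diff)
    then show ?thesis by simp
  qed (simp add: r_def)
  also have "(r * q \<mu> x - p \<mu> x) / (2 * c) = P \<nu> l 0 x"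
    using P_0[OF x l] by (simp add: r_def \<mu>_def c_def)
  finally show ?thesis by (simp add: \<mu>_def c_def r_def add_ac)
qed

text \<open>Here l counts downwards in the order of G, so the order \<mu> + 1, which carries
  \<sigma>, belongs to the step towards 0: the sign moves from upward to downward steps.\<close>

lemma deriv_product:
  assumes x: "x \<in> S" and l: "l = 0 \<or> - \<nu> + of_nat l \<noteq> 0"
  shows "((\<lambda>x. cpow lg x \<nu> * G (\<nu> - of_nat l) x) has_field_derivative
     \<sigma> * ((1 - ratio (- \<nu>) l) / 2) * (cpow lg x \<nu> * G (\<nu> - of_nat (l - 1)) x)
     + 1 * ((1 + ratio (- \<nu>) l) / 2) * (cpow lg x \<nu> * G (\<nu> - of_nat (l + 1)) x) + Q \<nu> l 0 x) (at x)"
proof -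
  define \<mu> where "\<mu> = \<nu> - of_nat l"
  define r where "r = ratio (- \<nu>) l"
  have r: "r * \<mu> = \<nu>" using ratio_times[OF l] by (simp add: r_def \<mu>_def algebra_simps)
  have x0: "x \<noteq> 0" "exp (lg x) = x" using log_branchD[OF branch] x by auto
  define c where "c = cpow lg x \<nu>"
  have "((\<lambda>x. cpow lg x \<nu> * G \<mu> x) has_field_derivative
      (\<nu> * cpow lg x (\<nu> - 1)) * G \<mu> x + D \<mu> x * c) (at x)"
    unfolding c_def by (intro DERIV_mult deriv_G has_field_derivative_cpow[OF branch] x)
  also have "cpow lg x (\<nu> - 1) = c / x" using x0 by (simp add: cpow_diff cpow_1 c_def)
  also have "(\<nu> * (c / x)) * G \<mu> x + D \<mu> x * c = c * (D \<mu> x + r * (\<mu> / x * G \<mu> x))"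
    using x0 unfolding r[symmetric] by (simp add: field_simps)
  also have "\<mu> / x * G \<mu> x = (G (\<mu> - 1) x - \<sigma> * G (\<mu> + 1) x - q \<mu> x) / 2"
    using rec_G[OF x, of \<mu>] by (simp add: field_simps)
  also have "D \<mu> x = (G (\<mu> - 1) x + \<sigma> * G (\<mu> + 1) x - p \<mu> x) / 2"
    using rec_D[OF x, of \<mu>] by (simp add: field_simps)
  also have "c * ((G (\<mu> - 1) x + \<sigma> * G (\<mu> + 1) x - p \<mu> x) / 2
        + r * ((G (\<mu> - 1) x - \<sigma> * G (\<mu> + 1) x - q \<mu> x) / 2))
     = \<sigma> * ((1 - r) / 2) * (c * G (\<mu> + 1) x) + 1 * ((1 + r) / 2) * (c * G (\<mu> - 1) x)
        - (r * q \<mu> x + p \<mu> x) * c / 2"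
    by (simp add: field_simps)
  also have "\<sigma> * ((1 - r) / 2) * (c * G (\<mu> + 1) x) = \<sigma> * ((1 - r) / 2) * (c * G (\<nu> - of_nat (l - 1)) x)"
  proof (cases "l = 0")
    case False
    then have "\<mu> + 1 = \<nu> - of_nat (l - 1)" by (simp add: \<mu>_def of_nat_diff)
    then show ?thesis by simp
  qed (simp add: r_def)
  also have "G (\<mu> - 1) x = G (\<nu> - of_nat (l + 1)) x"
    by (simp add: \<mu>_def diff_diff_eq add_ac)
  also have "\<sigma> * ((1 - r) / 2) * (c * G (\<nu> - of_nat (l - 1)) x)
        + 1 * ((1 + r) / 2) * (c * G (\<nu> - of_nat (l + 1)) x) - (r * q \<mu> x + p \<mu> x) * c / 2
     = \<sigma> * ((1 - r) / 2) * (c * G (\<nu> - of_nat (l - 1)) x)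
        + 1 * ((1 + r) / 2) * (c * G (\<nu> - of_nat (l + 1)) x) + Q \<nu> l 0 x"
    unfolding Q_0[OF x l] r_def \<mu>_def c_def
    by (simp only: diff_conv_add_uminus minus_mult_left minus_divide_left)
  finally show ?thesis by (simp only: \<mu>_def c_def r_def)
qed

text \<open>For products the sign counts n-k downward steps, for quotients n+k upward ones; as
  \<sigma> squares to 1, both formulas can use the exponent n+k. An odd walk has one extra step up,
  which is why the additional sign occurs only for quotients.\<close>

lemma sign_power: "k \<le> n \<Longrightarrow> \<sigma> ^ (n - k) = \<sigma> ^ (n + k)"
proof -
  assume "k \<le> n"
  then have "\<sigma> ^ (n + k) = \<sigma> ^ (n - k) * (\<sigma> ^ 2) ^ k"
    by (simp add: power_mult[symmetric] power_add[symmetric] add.commute)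
  moreover have "\<sigma> ^ 2 = 1" using sign by auto
  ultimately show ?thesis by simp
qed

lemma higher_deriv_quotient:
  assumes "z \<in> S"
  shows "\<nu> \<notin> (\<lambda>i. - of_nat i) ` {1..2 * n - 1} \<longrightarrow>
     (deriv ^^ (2 * n)) (\<lambda>x. G \<nu> x / cpow lg x \<nu>) z
     = (\<Sum>k\<le>n. \<sigma> ^ (n + k) * coeff_A n k \<nu> * (G (\<nu> + 2 * of_nat k) z / cpow lg z \<nu>))
     + (\<Sum>j<n. \<Sum>k\<le>j. \<sigma> ^ (k + j) * coeff_A j k \<nu> * P \<nu> (2 * k) (2 * n - 2 * j - 1) z)
     + (\<Sum>j<n. \<Sum>k\<le>j. \<sigma> ^ (k + j + 1) * coeff_B j k \<nu> * P \<nu> (2 * k + 1) (2 * n - 2 * j - 2) z)" (is ?E)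
    and "\<nu> \<notin> (\<lambda>i. - of_nat i) ` {1..2 * n} \<longrightarrow>
     (deriv ^^ (2 * n + 1)) (\<lambda>x. G \<nu> x / cpow lg x \<nu>) z
     = (\<Sum>k\<le>n. \<sigma> ^ (n + k + 1) * coeff_B n k \<nu> * (G (\<nu> + 2 * of_nat k + 1) z / cpow lg z \<nu>))
     + (\<Sum>j<n + 1. \<Sum>k\<le>j. \<sigma> ^ (k + j) * coeff_A j k \<nu> * P \<nu> (2 * k) (2 * n - 2 * j) z)
     + (\<Sum>j<n. \<Sum>k\<le>j. \<sigma> ^ (k + j + 1) * coeff_B j k \<nu> * P \<nu> (2 * k + 1) (2 * n - 2 * j - 1) z)" (is ?O)
proof -
  note H = higher_deriv_even_odd[where \<nu> = \<nu> and p = "P \<nu>" and a = 1 and b = \<sigma>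
    and g = "\<lambda>l x. G (\<nu> + of_nat l) x / cpow lg x \<nu>", OF log_branchD(1)[OF branch] assms
    deriv_quotient deriv_P]
  show ?E using H(1)[of n] by (simp add: add_ac)
  show ?O using H(2)[of n] by (simp add: add_ac)
qed

lemma higher_deriv_product:
  assumes "z \<in> S"
  shows "\<nu> \<notin> of_nat ` {1..2 * n - 1} \<longrightarrow>
     (deriv ^^ (2 * n)) (\<lambda>x. cpow lg x \<nu> * G \<nu> x) z
     = (\<Sum>k\<le>n. \<sigma> ^ (n + k) * coeff_A n k (- \<nu>) * (cpow lg z \<nu> * G (\<nu> - 2 * of_nat k) z))
     + (\<Sum>j<n. \<Sum>k\<le>j. \<sigma> ^ (k + j) * coeff_A j k (- \<nu>) * Q \<nu> (2 * k) (2 * n - 2 * j - 1) z)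
     + (\<Sum>j<n. \<Sum>k\<le>j. \<sigma> ^ (k + j) * coeff_B j k (- \<nu>) * Q \<nu> (2 * k + 1) (2 * n - 2 * j - 2) z)"
    (is "_ \<longrightarrow> ?E")
    and "\<nu> \<notin> of_nat ` {1..2 * n} \<longrightarrow>
     (deriv ^^ (2 * n + 1)) (\<lambda>x. cpow lg x \<nu> * G \<nu> x) z
     = (\<Sum>k\<le>n. \<sigma> ^ (n + k) * coeff_B n k (- \<nu>) * (cpow lg z \<nu> * G (\<nu> - 2 * of_nat k - 1) z))
     + (\<Sum>j<n + 1. \<Sum>k\<le>j. \<sigma> ^ (k + j) * coeff_A j k (- \<nu>) * Q \<nu> (2 * k) (2 * n - 2 * j) z)
     + (\<Sum>j<n. \<Sum>k\<le>j. \<sigma> ^ (k + j) * coeff_B j k (- \<nu>) * Q \<nu> (2 * k + 1) (2 * n - 2 * j - 1) z)"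
    (is "_ \<longrightarrow> ?O")
proof -
  note H = higher_deriv_even_odd[where \<nu> = "- \<nu>" and p = "Q \<nu>" and a = \<sigma> and b = 1
    and g = "\<lambda>l x. cpow lg x \<nu> * G (\<nu> - of_nat l) x", OF log_branchD(1)[OF branch] assms
    deriv_product deriv_Q]
  have neg: "- \<nu> \<notin> (\<lambda>i. - of_nat i) ` {1..N}" if "\<nu> \<notin> of_nat ` {1..N}" for N
    using that by (auto simp: image_iff)
  have swap: "\<sigma> ^ (k + j) = \<sigma> ^ (j - k)" if "k \<le> j" for j k
    using sign_power[OF that] by (simp add: add.commute)
  have d: "\<nu> - 2 * of_nat k - 1 = \<nu> - (1 + 2 * of_nat k)" for k by simp
  show "\<nu> \<notin> of_nat ` {1..2 * n - 1} \<longrightarrow> ?E"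
    using H(1)[of n] neg[of "2 * n - 1"] by (simp add: swap sign_power cong: sum.cong_simp)
  show "\<nu> \<notin> of_nat ` {1..2 * n} \<longrightarrow> ?O"
    using H(2)[of n] neg[of "2 * n"] by (simp add: swap sign_power d cong: sum.cong_simp del: funpow.simps)
qed

end

section \<open>Struve functions\<close>

lemma half_powr: "(1 / 2 :: complex) powr a = 1 / 2 powr a"
proof -
  have "Ln (1 / 2 :: complex) = - Ln 2"
    using Ln_of_real[of "1 / 2"] Ln_of_real[of 2] by (simp add: ln_div)
  then show ?thesis by (simp add: powr_def exp_minus field_simps)
qed

lemma rGamma_half: "rGamma (1 / 2 :: complex) = 1 / of_real (sqrt pi)"
  unfolding rGamma_inverse_Gamma Gamma_one_half_complex by (rule inverse_eq_divide)

lemma rGamma_three_halves: "rGamma (3 / 2 :: complex) = 2 / of_real (sqrt pi)"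
  using rGamma_plus1[of "1 / 2 :: complex"] by (simp add: rGamma_half)

text \<open>The coefficient of (x^2)^k once x^(\<mu>+1) has been split off; \<sigma> = -1 gives H
  and \<sigma> = 1 gives L.\<close>

definition struve_coeff :: "complex \<Rightarrow> complex \<Rightarrow> nat \<Rightarrow> complex" where
  "struve_coeff \<sigma> \<mu> k = \<sigma> ^ k * rGamma (of_nat k + 3/2) * rGamma (of_nat k + \<mu> + 3/2)
     / 2 powr (2 * of_nat k + \<mu> + 1)"

definition struve_term :: "complex \<Rightarrow> (complex \<Rightarrow> complex) \<Rightarrow> complex \<Rightarrow> complex \<Rightarrow> nat \<Rightarrow> complex" where
  "struve_term \<sigma> lg \<mu> x k = \<sigma> ^ k
      * (cpow lg x (2 * of_nat k + \<mu> + 1) / 2 powr (2 * of_nat k + \<mu> + 1))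
      * rGamma (of_nat k + 3/2) * rGamma (of_nat k + \<mu> + 3/2)"

definition struve_gen :: "complex \<Rightarrow> (complex \<Rightarrow> complex) \<Rightarrow> complex \<Rightarrow> complex \<Rightarrow> complex" where
  "struve_gen \<sigma> lg \<mu> x = (\<Sum>k. struve_term \<sigma> lg \<mu> x k)"

definition struve_gen_deriv :: "complex \<Rightarrow> (complex \<Rightarrow> complex) \<Rightarrow> complex \<Rightarrow> complex \<Rightarrow> complex" where
  "struve_gen_deriv \<sigma> lg \<mu> x = (\<Sum>k. (2 * of_nat k + \<mu> + 1) * struve_term \<sigma> lg \<mu> x k) / x"

text \<open>This is (x/2)^\<mu> / (sqrt pi Gamma(\<mu> + 3/2)), the k = 0 term of the series divided
  by x.\<close>

definition struve_inhom :: "(complex \<Rightarrow> complex) \<Rightarrow> complex \<Rightarrow> complex \<Rightarrow> complex" where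
  "struve_inhom lg \<mu> x = cpow lg x \<mu> / 2 powr \<mu> / of_real (sqrt pi) * rGamma (\<mu> + 3/2)"

lemma struve_term_eq:
  assumes "exp (lg x) = x"
  shows "struve_term \<sigma> lg \<mu> x k = cpow lg x (\<mu> + 1) * (struve_coeff \<sigma> \<mu> k * (x ^ 2) ^ k)"
proof -
  have "cpow lg x (2 * of_nat k + \<mu> + 1) = cpow lg x (of_nat (2 * k) + (\<mu> + 1))"
    by (simp add: add_ac)
  also have "\<dots> = (x ^ 2) ^ k * cpow lg x (\<mu> + 1)"
    unfolding cpow_add cpow_of_nat[of lg x, OF assms] by (simp add: power_mult)
  finally show ?thesis
    by (simp add: struve_term_def struve_coeff_def)
qed

text \<open>The form without division stays valid when k + \<mu> + 3/2 = 0, that is, at a pole of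
  Gamma.\<close>

lemma struve_coeff_Suc:
  "4 * (of_nat k + 3/2) * (of_nat k + \<mu> + 3/2) * struve_coeff \<sigma> \<mu> (Suc k) = \<sigma> * struve_coeff \<sigma> \<mu> k"
proof -
  have "rGamma (of_nat k + 3/2 :: complex) = (of_nat k + 3/2) * rGamma (of_nat (Suc k) + 3/2)"
    using rGamma_plus1[of "of_nat k + 3/2 :: complex"] by (simp add: add_ac)
  moreover have "rGamma (of_nat k + \<mu> + 3/2) = (of_nat k + \<mu> + 3/2) * rGamma (of_nat (Suc k) + \<mu> + 3/2)"
    using rGamma_plus1[of "of_nat k + \<mu> + 3/2"] by (simp add: add_ac)
  moreover have "2 powr (2 * of_nat (Suc k) + \<mu> + 1) = 4 * (2 powr (2 * of_nat k + \<mu> + 1) :: complex)"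
  proof -
    have "2 * of_nat (Suc k) + \<mu> + 1 = (2 * of_nat k + \<mu> + 1) + 1 + 1" by simp
    then show ?thesis by (simp only: powr_add) simp
  qed
  moreover have "4 * a * b * (\<sigma> ^ Suc k * g * h / (4 * P)) = \<sigma> * (\<sigma> ^ k * (a * g) * (b * h) / P)"
    for a b g h P :: complex
    by (simp add: mult_ac)
  ultimately show ?thesis
    unfolding struve_coeff_def by (simp only:)
qed

text \<open>Once k \<ge> |\<mu>| + |w|, the factors satisfy |k + 3/2| \<ge> 1 and |k + \<mu> + 3/2|
  \<ge> |w|, so consecutive terms shrink at least by the factor 4; 1/2 suffices for the ratio
  test.\<close>

lemma summable_struve_coeff:
  assumes "norm \<sigma> = 1"
  shows "summable (\<lambda>k. struve_coeff \<sigma> \<mu> k * w ^ k)"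
proof (rule summable_ratio_test)
  show "(1 / 2 :: real) < 1" by simp
  fix k assume k: "nat \<lceil>norm \<mu> + norm w\<rceil> \<le> k"
  then have k': "norm \<mu> + norm w \<le> real k" by linarith
  define a where "a = (of_nat k + 3/2 :: complex)"
  define b where "b = of_nat k + \<mu> + 3/2"
  have a: "norm a \<ge> 1"
  proof -
    have "a = of_real (real k + 3/2)" by (simp add: a_def)
    then show ?thesis by (simp only: norm_of_real)
  qed
  have b: "norm b \<ge> norm w"
  proof -
    have "norm (of_real (real k + 3/2) :: complex) \<le> norm b + norm \<mu>"
      using norm_triangle_ineq[of b "- \<mu>"] by (simp add: b_def)
    then show ?thesis using k' by (simp only: norm_of_real)
  qed
  have "norm (struve_coeff \<sigma> \<mu> (Suc k)) * norm w \<le> 1 / 2 * norm (struve_coeff \<sigma> \<mu> k)"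
  proof -
    have "norm (4 * a * b * struve_coeff \<sigma> \<mu> (Suc k)) = norm (\<sigma> * struve_coeff \<sigma> \<mu> k)"
      unfolding a_def b_def struve_coeff_Suc ..
    then have e: "4 * (norm a * norm b) * norm (struve_coeff \<sigma> \<mu> (Suc k)) = norm (struve_coeff \<sigma> \<mu> k)"
      using assms by (simp add: norm_mult)
    have "norm w \<le> norm a * norm b"
      using mult_mono[OF a b] by simp
    then have "norm w * norm (struve_coeff \<sigma> \<mu> (Suc k)) \<le> norm a * norm b * norm (struve_coeff \<sigma> \<mu> (Suc k))"
      by (rule mult_right_mono) simp
    moreover have "0 \<le> norm a * norm b * norm (struve_coeff \<sigma> \<mu> (Suc k))" by simp
    ultimately show ?thesis unfolding e[symmetric] by (simp only: mult_ac)
  qed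
  then have "norm (struve_coeff \<sigma> \<mu> (Suc k)) * norm w * norm w ^ k
      \<le> 1 / 2 * norm (struve_coeff \<sigma> \<mu> k) * norm w ^ k"
    by (rule mult_right_mono) simp
  then show "norm (struve_coeff \<sigma> \<mu> (Suc k) * w ^ Suc k) \<le> 1 / 2 * norm (struve_coeff \<sigma> \<mu> k * w ^ k)"
    by (simp add: norm_mult norm_power mult_ac)
qed

lemma struve_gen_sums:
  assumes "norm \<sigma> = 1" "exp (lg x) = x"
  shows "struve_term \<sigma> lg \<mu> x sums struve_gen \<sigma> lg \<mu> x"
proof -
  have "summable (\<lambda>k. struve_term \<sigma> lg \<mu> x k)"
    unfolding struve_term_eq[of lg x, OF assms(2)]
    by (intro summable_mult summable_struve_coeff assms(1))
  then show ?thesis unfolding struve_gen_def by (rule summable_sums)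
qed

text \<open>Splitting off x^(\<mu>+1) leaves an everywhere convergent power series in x^2, so
  termwise differentiation is safe. The Euler operator x d/dx multiplies the k-th term by its
  exponent.\<close>

lemma struve_gen_deriv:
  assumes \<sigma>: "norm \<sigma> = 1" and S: "log_branch_on S lg" "x \<in> S"
  shows "(\<lambda>k. (2 * of_nat k + \<mu> + 1) * struve_term \<sigma> lg \<mu> x k) sums (x * struve_gen_deriv \<sigma> lg \<mu> x)"
    and "(struve_gen \<sigma> lg \<mu> has_field_derivative struve_gen_deriv \<sigma> lg \<mu> x) (at x)"
proof -
  have x: "x \<noteq> 0" "exp (lg x) = x" using log_branchD[OF S(1)] S(2) by auto
  define c where "c = struve_coeff \<sigma> \<mu>"
  define \<Phi> where "\<Phi> w = (\<Sum>k. c k * w ^ k)" for w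
  define \<Psi> where "\<Psi> w = (\<Sum>k. diffs c k * w ^ k)" for w
  have sm: "summable (\<lambda>k. c k * w ^ k)" for w
    unfolding c_def by (rule summable_struve_coeff[OF \<sigma>])
  have d\<Phi>: "(\<Phi> has_field_derivative \<Psi> w) (at w)" for w
    unfolding \<Phi>_def \<Psi>_def by (rule termdiffs_strong_converges_everywhere[OF sm])
  have gen: "struve_gen \<sigma> lg \<mu> y = cpow lg y (\<mu> + 1) * \<Phi> (y ^ 2)" if "y \<in> S" for y
    using log_branchD(2)[OF S(1) that] sm
    by (simp add: struve_gen_def struve_term_eq \<Phi>_def suminf_mult c_def)
  have "(\<lambda>k. of_nat k * c k * w ^ (k - Suc 0)) sums \<Psi> w" for w
    unfolding \<Psi>_def by (rule diffs_equiv) (rule termdiff_converges_all[OF sm])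
  \<comment> \<open>Multiplication by x^2 restores the exponent k; for k = 0 the factor
    \<open>of_nat k\<close> removes the term with the truncated exponent.\<close>
  from sums_mult[OF this, of "x ^ 2" "x ^ 2"]
  have s\<Psi>: "(\<lambda>k. of_nat k * (c k * (x ^ 2) ^ k)) sums (x ^ 2 * \<Psi> (x ^ 2))"
  proof (rule sums_cong[THEN iffD1, rotated])
    show "x ^ 2 * (of_nat k * c k * (x ^ 2) ^ (k - Suc 0)) = of_nat k * (c k * (x ^ 2) ^ k)" for k
      by (cases k) simp_all
  qed
  have s\<Phi>: "(\<lambda>k. c k * (x ^ 2) ^ k) sums \<Phi> (x ^ 2)"
    unfolding \<Phi>_def by (rule summable_sums[OF sm])
  define L where "L = cpow lg x (\<mu> + 1) * (2 * (x ^ 2 * \<Psi> (x ^ 2)) + (\<mu> + 1) * \<Phi> (x ^ 2))"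
  have "(\<lambda>k. cpow lg x (\<mu> + 1) * (2 * (of_nat k * (c k * (x ^ 2) ^ k)) + (\<mu> + 1) * (c k * (x ^ 2) ^ k))) sums L"
    unfolding L_def by (intro sums_mult sums_add s\<Psi> s\<Phi>)
  then have sL: "(\<lambda>k. (2 * of_nat k + \<mu> + 1) * struve_term \<sigma> lg \<mu> x k) sums L"
    by (simp add: struve_term_eq[of lg x, OF x(2)] c_def algebra_simps)
  then have L: "L = x * struve_gen_deriv \<sigma> lg \<mu> x"
    using x(1) by (simp add: struve_gen_deriv_def sums_iff)
  show "(\<lambda>k. (2 * of_nat k + \<mu> + 1) * struve_term \<sigma> lg \<mu> x k) sums (x * struve_gen_deriv \<sigma> lg \<mu> x)"
    using sL unfolding L .
  have "((\<lambda>y. \<Phi> (y ^ 2)) has_field_derivative \<Psi> (x ^ 2) * (2 * x)) (at x)"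
    by (rule DERIV_chain2[OF d\<Phi>]) (auto intro!: derivative_eq_intros)
  with has_field_derivative_cpow[OF S, of "\<mu> + 1"]
  have "((\<lambda>y. cpow lg y (\<mu> + 1) * \<Phi> (y ^ 2)) has_field_derivative
      ((\<mu> + 1) * cpow lg x (\<mu> + 1 - 1)) * \<Phi> (x ^ 2) + \<Psi> (x ^ 2) * (2 * x) * cpow lg x (\<mu> + 1)) (at x)"
    by (rule DERIV_mult)
  also have "((\<mu> + 1) * cpow lg x (\<mu> + 1 - 1)) * \<Phi> (x ^ 2) + \<Psi> (x ^ 2) * (2 * x) * cpow lg x (\<mu> + 1) = L / x"
    using x by (simp only: L_def cpow_diff cpow_1) (simp add: field_simps power2_eq_square)
  also have "L / x = struve_gen_deriv \<sigma> lg \<mu> x"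
    using x(1) unfolding L by simp
  finally have "((\<lambda>y. cpow lg y (\<mu> + 1) * \<Phi> (y ^ 2)) has_field_derivative struve_gen_deriv \<sigma> lg \<mu> x) (at x)" .
  then show "(struve_gen \<sigma> lg \<mu> has_field_derivative struve_gen_deriv \<sigma> lg \<mu> x) (at x)"
    by (rule has_field_derivative_transform_within_open[OF _ log_branchD(1)[OF S(1)] S(2)]) (simp add: gen)
qed

lemma struve_term_lower:
  assumes "exp (lg x) = x"
  shows "(2 * of_nat k + 2 * \<mu> + 1) * struve_term \<sigma> lg \<mu> x k = x * struve_term \<sigma> lg (\<mu> - 1) x k"
proof -
  have e: "2 * of_nat k + \<mu> + 1 = (2 * of_nat k + (\<mu> - 1) + 1) + 1" by simp
  have c: "cpow lg x (2 * of_nat k + \<mu> + 1) / 2 powr (2 * of_nat k + \<mu> + 1)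
     = (cpow lg x (2 * of_nat k + (\<mu> - 1) + 1) / 2 powr (2 * of_nat k + (\<mu> - 1) + 1)) * (x / 2)"
    unfolding e cpow_add powr_add cpow_1[of lg x, OF assms] by simp
  have e: "of_nat k + (\<mu> - 1) + 3/2 = of_nat k + \<mu> + 1/2" "of_nat k + \<mu> + 1/2 + 1 = of_nat k + \<mu> + 3/2"
    by simp_all
  have r: "rGamma (of_nat k + (\<mu> - 1) + 3/2) = (of_nat k + \<mu> + 1/2) * rGamma (of_nat k + \<mu> + 3/2)"
    using rGamma_plus1[of "of_nat k + \<mu> + 1/2"] unfolding e by simp
  show ?thesis
    unfolding struve_term_def c r by (simp add: field_simps)
qed

lemma struve_term_upper:
  assumes "exp (lg x) = x"
  shows "(2 * of_nat (Suc k) + 1) * struve_term \<sigma> lg \<mu> x (Suc k) = x * (\<sigma> * struve_term \<sigma> lg (\<mu> + 1) x k)"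
proof -
  have e: "2 * of_nat (Suc k) + \<mu> + 1 = (2 * of_nat k + (\<mu> + 1) + 1) + 1" by simp
  have c: "cpow lg x (2 * of_nat (Suc k) + \<mu> + 1) / 2 powr (2 * of_nat (Suc k) + \<mu> + 1)
     = (cpow lg x (2 * of_nat k + (\<mu> + 1) + 1) / 2 powr (2 * of_nat k + (\<mu> + 1) + 1)) * (x / 2)"
    unfolding e cpow_add powr_add cpow_1[of lg x, OF assms] by simp
  have r: "rGamma (of_nat k + 3/2 :: complex) = (of_nat k + 3/2) * rGamma (of_nat (Suc k) + 3/2)"
    using rGamma_plus1[of "of_nat k + 3/2 :: complex"] by (simp add: add_ac)
  have r2: "of_nat (Suc k) + \<mu> + 3/2 = of_nat k + (\<mu> + 1) + 3/2" by simp
  show ?thesis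
    unfolding struve_term_def c r r2 by (simp add: field_simps)
qed

lemma struve_term_0:
  assumes "exp (lg x) = x"
  shows "struve_term \<sigma> lg \<mu> x 0 = x * struve_inhom lg \<mu> x"
  by (simp add: struve_term_def struve_inhom_def cpow_add cpow_1[of lg x, OF assms] powr_add rGamma_three_halves)

text \<open>In the k-th term, x G' + \<mu> G produces the factor 2k+2\<mu>+1, absorbed by the second
  reciprocal Gamma factor, which lowers the order. The factor 2k+1 from x G' - \<mu> G is absorbed
  by the first one, which raises the order and shifts k; the k = 0 term is left over as the
  inhomogeneity.\<close>

lemma struve_gen_recurrences:
  assumes \<sigma>: "norm \<sigma> = 1" and S: "log_branch_on S lg" "x \<in> S"
  shows "x * struve_gen_deriv \<sigma> lg \<mu> x + \<mu> * struve_gen \<sigma> lg \<mu> x = x * struve_gen \<sigma> lg (\<mu> - 1) x"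
    and "x * struve_gen_deriv \<sigma> lg \<mu> x - \<mu> * struve_gen \<sigma> lg \<mu> x
       = x * (\<sigma> * struve_gen \<sigma> lg (\<mu> + 1) x) + x * struve_inhom lg \<mu> x"
proof -
  have x: "exp (lg x) = x" using log_branchD[OF S(1)] S(2) by auto
  note s = struve_gen_deriv(1)[OF \<sigma> S, of \<mu>] sums_mult[OF struve_gen_sums[of \<sigma> lg x, OF \<sigma> x, of \<mu>], of \<mu>]
  have "(2 * of_nat k + \<mu> + 1) * struve_term \<sigma> lg \<mu> x k + \<mu> * struve_term \<sigma> lg \<mu> x k
      = x * struve_term \<sigma> lg (\<mu> - 1) x k" for k
    using struve_term_lower[of lg x k \<mu> \<sigma>, OF x] by (simp add: algebra_simps)
  with sums_add[OF s] sums_mult[OF struve_gen_sums[of \<sigma> lg x, OF \<sigma> x, of "\<mu> - 1"], of x]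
  show "x * struve_gen_deriv \<sigma> lg \<mu> x + \<mu> * struve_gen \<sigma> lg \<mu> x = x * struve_gen \<sigma> lg (\<mu> - 1) x"
    by (simp add: sums_iff)
  have "(2 * of_nat k + \<mu> + 1) * struve_term \<sigma> lg \<mu> x k - \<mu> * struve_term \<sigma> lg \<mu> x k
      = (2 * of_nat k + 1) * struve_term \<sigma> lg \<mu> x k" for k
    by (simp add: algebra_simps)
  with sums_diff[OF s]
  have "(\<lambda>k. (2 * of_nat k + 1) * struve_term \<sigma> lg \<mu> x k) sums
      (x * struve_gen_deriv \<sigma> lg \<mu> x - \<mu> * struve_gen \<sigma> lg \<mu> x)"
    by simp
  moreover have "(\<lambda>k. (2 * of_nat (Suc k) + 1) * struve_term \<sigma> lg \<mu> x (Suc k)) sums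
      (x * (\<sigma> * struve_gen \<sigma> lg (\<mu> + 1) x))"
    unfolding struve_term_upper[of lg x, OF x] by (intro sums_mult struve_gen_sums \<sigma> x)
  then have "(\<lambda>k. (2 * of_nat k + 1) * struve_term \<sigma> lg \<mu> x k) sums
      (x * (\<sigma> * struve_gen \<sigma> lg (\<mu> + 1) x) + (2 * of_nat 0 + 1) * struve_term \<sigma> lg \<mu> x 0)"
    by (rule sums_Suc)
  ultimately show "x * struve_gen_deriv \<sigma> lg \<mu> x - \<mu> * struve_gen \<sigma> lg \<mu> x
       = x * (\<sigma> * struve_gen \<sigma> lg (\<mu> + 1) x) + x * struve_inhom lg \<mu> x"
    using sums_unique2 by (fastforce simp: struve_term_0[of lg x, OF x])
qed

section \<open>The Struve functions as an instance of the common recurrences\<close>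

lemma one_plus_ratio:
  assumes "l = 0 \<or> \<nu> + of_nat l \<noteq> 0"
  shows "(if \<nu> = 0 \<and> l = 0 then 2 else (2 * \<nu> + of_nat l) / (\<nu> + of_nat l)) = 1 + ratio \<nu> l"
proof (cases "\<nu> = 0 \<and> l = 0")
  case False
  with assms have nz: "\<nu> + of_nat l \<noteq> 0" by auto
  have "1 + ratio \<nu> l = 2 * ((1 + ratio \<nu> l) / 2)" by simp
  also have "\<dots> = (2 * \<nu> + of_nat l) / (\<nu> + of_nat l)"
    unfolding half_ratio(2)[OF nz]
    by (simp only: times_divide_eq_right mult_divide_mult_cancel_left[OF zero_neq_numeral[symmetric]])
  finally show ?thesis using False by auto
qed simp

lemma one_minus_ratio:
  assumes "l = 0 \<or> - \<nu> + of_nat l \<noteq> 0"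
  shows "(if \<nu> = 0 \<and> l = 0 then 0 else of_nat l / (of_nat l - \<nu>)) = 1 - ratio (- \<nu>) l"
  using assms by (auto simp: ratio_def divide_simps)

lemma struve_type_recurrence_struve:
  assumes S: "log_branch_on S lg" and \<sigma>: "\<sigma> = 1 \<or> \<sigma> = -1"
  shows "struve_type_recurrence S lg \<sigma> (struve_gen \<sigma> lg) (struve_gen_deriv \<sigma> lg)
     (\<lambda>\<mu> x. - struve_inhom lg \<mu> x) (struve_inhom lg) (t_fun lg) (u_fun lg)"
proof
  have \<sigma>': "norm \<sigma> = 1" using \<sigma> by auto
  fix x assume x: "x \<in> S"
  have x0: "x \<noteq> 0" using log_branchD[OF S] x by auto
  fix \<mu> :: complex
  show "(struve_gen \<sigma> lg \<mu> has_field_derivative struve_gen_deriv \<sigma> lg \<mu> x) (at x)"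
    by (rule struve_gen_deriv(2)[OF \<sigma>' S x])
  define X where "X = struve_gen \<sigma> lg (\<mu> - 1) x"
  define Y where "Y = \<sigma> * struve_gen \<sigma> lg (\<mu> + 1) x"
  define Z where "Z = struve_gen_deriv \<sigma> lg \<mu> x"
  define I where "I = struve_inhom lg \<mu> x"
  define W where "W = \<mu> / x * struve_gen \<sigma> lg \<mu> x"
  have "x * (Z + W) = x * X" "x * (Z - W) = x * (Y + I)"
    using struve_gen_recurrences[OF \<sigma>' S x, of \<mu>] x0
    by (simp_all add: X_def Y_def Z_def I_def W_def field_simps)
  then have "Z + W = X" "Z - W = Y + I" using x0 by (auto simp only: mult_cancel_left)
  then have "X + Y = 2 * Z + - I" "X - Y = 2 * W + I" by (auto simp: algebra_simps)
  then show "struve_gen \<sigma> lg (\<mu> - 1) x + \<sigma> * struve_gen \<sigma> lg (\<mu> + 1) x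
      = 2 * struve_gen_deriv \<sigma> lg \<mu> x + - struve_inhom lg \<mu> x"
    "struve_gen \<sigma> lg (\<mu> - 1) x - \<sigma> * struve_gen \<sigma> lg (\<mu> + 1) x
      = 2 * \<mu> / x * struve_gen \<sigma> lg \<mu> x + struve_inhom lg \<mu> x"
    by (simp_all add: X_def Y_def Z_def I_def W_def)
next
  fix x \<nu> :: complex and l :: nat assume x: "x \<in> S" and l: "l = 0 \<or> \<nu> + of_nat l \<noteq> 0"
  show "t_fun lg \<nu> l 0 x = (ratio \<nu> l * struve_inhom lg (\<nu> + of_nat l) x
      - - struve_inhom lg (\<nu> + of_nat l) x) / (2 * cpow lg x \<nu>)"
    unfolding t_fun_def one_plus_ratio[OF l]
    by (simp add: struve_inhom_def half_powr powr_add cpow_add desc_fact_def) (simp add: field_simps)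
next
  fix x \<nu> :: complex and l :: nat assume x: "x \<in> S" and l: "l = 0 \<or> - \<nu> + of_nat l \<noteq> 0"
  have "cpow lg x (2 * \<nu> - of_nat l - of_nat 0) = cpow lg x (\<nu> - of_nat l) * cpow lg x \<nu>"
    by (simp add: cpow_add[symmetric])
  then show "u_fun lg \<nu> l 0 x = - (ratio (- \<nu>) l * struve_inhom lg (\<nu> - of_nat l) x
      + - struve_inhom lg (\<nu> - of_nat l) x) * cpow lg x \<nu> / 2"
    unfolding u_fun_def one_minus_ratio[OF l]
    by (simp add: struve_inhom_def half_powr powr_add desc_fact_def) (simp add: field_simps)
next
  fix x \<nu> :: complex and l m :: nat assume x: "x \<in> S"
  show "(t_fun lg \<nu> l m has_field_derivative t_fun lg \<nu> l (Suc m) x) (at x)"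
    unfolding t_fun_def by (rule has_field_derivative_desc_fact_cpow[OF S x])
  show "(u_fun lg \<nu> l m has_field_derivative u_fun lg \<nu> l (Suc m) x) (at x)"
    unfolding u_fun_def by (rule has_field_derivative_desc_fact_cpow[OF S x])
qed (use S \<sigma> in auto)

section \<open>Anger and Weber functions\<close>

definition anger_gen :: "(complex \<Rightarrow> complex) \<Rightarrow> complex \<Rightarrow> complex \<Rightarrow> complex" where
  "anger_gen f \<mu> z = 1 / of_real pi
      * integral {0..pi} (\<lambda>\<theta>. f (\<mu> * of_real \<theta> - z * of_real (sin \<theta>)))"

definition anger_gen_deriv :: "(complex \<Rightarrow> complex) \<Rightarrow> complex \<Rightarrow> complex \<Rightarrow> complex" where
  "anger_gen_deriv f' \<mu> z = 1 / of_real pi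
      * integral {0..pi} (\<lambda>\<theta>. - of_real (sin \<theta>) * f' (\<mu> * of_real \<theta> - z * of_real (sin \<theta>)))"

text \<open>Anger and Weber functions differ only in the choice of cos or sin. The arguments below
  use that f' is the derivative of f, that f'' = -f, and two addition formulas.\<close>

locale trig_pair =
  fixes f f' :: "complex \<Rightarrow> complex"
  assumes trig: "f = cos \<and> f' = (\<lambda>x. - sin x) \<or> f = sin \<and> f' = cos"
begin

lemma deriv_f: "(f has_field_derivative f' x) (at x within A)"
  and deriv_f': "(f' has_field_derivative - f x) (at x within A)"
  and cont_f: "continuous_on A f"
  and cont_f': "continuous_on A f'"
  and f_sum: "f (a - b) + f (a + b) = 2 * (f a * cos b)"
  and f_diff: "f (a - b) - f (a + b) = 2 * (- sin b * f' a)"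
  using trig by (auto intro!: derivative_eq_intros continuous_intros
      simp: sin_add sin_diff cos_add cos_diff)

lemma integrable:
  "(\<lambda>\<theta>. f (\<mu> * of_real \<theta> - z * of_real (sin \<theta>))) integrable_on {0..pi}"
  "(\<lambda>\<theta>. - of_real (sin \<theta>) * f' (\<mu> * of_real \<theta> - z * of_real (sin \<theta>))) integrable_on {0..pi}"
  by (intro integrable_continuous_interval continuous_intros
      continuous_on_compose2[OF cont_f[of UNIV]] continuous_on_compose2[OF cont_f'[of UNIV]] subset_UNIV)+

lemma deriv_anger_gen:
  "(anger_gen f \<mu> has_field_derivative anger_gen_deriv f' \<mu> z) (at z)"
proof -
  have "((\<lambda>z. integral (cbox 0 pi) (\<lambda>\<theta>. f (\<mu> * of_real \<theta> - z * of_real (sin \<theta>)))) has_field_derivative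
     integral (cbox 0 pi) (\<lambda>\<theta>. - of_real (sin \<theta>) * f' (\<mu> * of_real \<theta> - z * of_real (sin \<theta>)))) (at z within UNIV)"
  proof (rule leibniz_rule_field_derivative)
    show "((\<lambda>x. f (\<mu> * of_real t - x * of_real (sin t))) has_field_derivative
        - of_real (sin t) * f' (\<mu> * of_real t - x * of_real (sin t))) (at x within UNIV)" for x t
    proof -
      have "((\<lambda>x. \<mu> * of_real t - x * of_real (sin t)) has_field_derivative - of_real (sin t)) (at x)"
        by (auto intro!: derivative_eq_intros)
      from DERIV_chain2[OF deriv_f this] show ?thesis by (simp add: mult.commute)
    qed
    show "continuous_on (UNIV \<times> cbox 0 pi)
        (\<lambda>(x, t). - of_real (sin t) * f' (\<mu> * of_real t - x * of_real (sin t)))"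
      unfolding split_beta
      by (intro continuous_intros continuous_on_compose2[OF cont_f'[of UNIV]] subset_UNIV)
  qed (use integrable in auto)
  from DERIV_cmult[OF this, of "1 / of_real pi"] show ?thesis
    by (simp add: anger_gen_def[abs_def] anger_gen_deriv_def)
qed

text \<open>Both orders \<mu> \<plusminus> 1 shift the phase by \<theta>. The difference gives the
  factor sin \<theta> of the derivative under the integral, the sum the factor cos \<theta>, which
  is handled through the derivative of the phase.\<close>

lemma anger_gen_recurrences:
  shows "anger_gen f (\<mu> - 1) z - anger_gen f (\<mu> + 1) z = 2 * anger_gen_deriv f' \<mu> z"
    and "z * (anger_gen f (\<mu> - 1) z + anger_gen f (\<mu> + 1) z)
      = 2 * \<mu> * anger_gen f \<mu> z - 2 * (f' 0 - f' (of_real pi * \<mu>)) / of_real pi"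
proof -
  define \<phi> where "\<phi> \<theta> = \<mu> * of_real \<theta> - z * of_real (sin \<theta>)" for \<theta> :: real
  have lo: "f ((\<mu> - 1) * of_real \<theta> - z * of_real (sin \<theta>)) = f (\<phi> \<theta> - of_real \<theta>)" for \<theta>
    by (simp add: \<phi>_def algebra_simps)
  have up: "f ((\<mu> + 1) * of_real \<theta> - z * of_real (sin \<theta>)) = f (\<phi> \<theta> + of_real \<theta>)" for \<theta>
    by (simp add: \<phi>_def algebra_simps)
  note int = integrable(1)[of "\<mu> - 1" z, unfolded lo] integrable(1)[of "\<mu> + 1" z, unfolded up]
  have "integral {0..pi} (\<lambda>\<theta>. f (\<phi> \<theta> - of_real \<theta>)) - integral {0..pi} (\<lambda>\<theta>. f (\<phi> \<theta> + of_real \<theta>))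
      = integral {0..pi} (\<lambda>\<theta>. 2 * (- of_real (sin \<theta>) * f' (\<phi> \<theta>)))"
    unfolding integral_diff[OF int, symmetric] by (simp add: f_diff sin_of_real)
  also have "\<dots> = 2 * integral {0..pi} (\<lambda>\<theta>. - of_real (sin \<theta>) * f' (\<phi> \<theta>))"
    by (rule integral_mult_right)
  finally show "anger_gen f (\<mu> - 1) z - anger_gen f (\<mu> + 1) z = 2 * anger_gen_deriv f' \<mu> z"
    unfolding anger_gen_def anger_gen_deriv_def lo up
    by (simp add: \<phi>_def diff_divide_distrib[symmetric] del: integral_mult_right)
  have "integral {0..pi} (\<lambda>\<theta>. f (\<phi> \<theta> - of_real \<theta>)) + integral {0..pi} (\<lambda>\<theta>. f (\<phi> \<theta> + of_real \<theta>))
      = integral {0..pi} (\<lambda>\<theta>. 2 * (f (\<phi> \<theta>) * of_real (cos \<theta>)))"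
    unfolding integral_add[OF int, symmetric] by (simp add: f_sum cos_of_real)
  also have "\<dots> = 2 * integral {0..pi} (\<lambda>\<theta>. f (\<phi> \<theta>) * of_real (cos \<theta>))"
    by (rule integral_mult_right)
  finally have sum: "anger_gen f (\<mu> - 1) z + anger_gen f (\<mu> + 1) z
      = 2 / of_real pi * integral {0..pi} (\<lambda>\<theta>. f (\<phi> \<theta>) * of_real (cos \<theta>))"
    unfolding anger_gen_def lo up by (simp add: add_divide_distrib[symmetric] del: integral_mult_right)
  \<comment> \<open>The integrand is the exact derivative of -f'(\<phi> \<theta>). The phase runs
    from 0 to pi * \<mu>, which produces the boundary term f'(0) - f'(pi * \<mu>).\<close>
  have "((\<lambda>\<theta>. (\<mu> - z * of_real (cos \<theta>)) * f (\<phi> \<theta>)) has_integral (- f' (\<phi> pi)) - (- f' (\<phi> 0))) {0..pi}"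
  proof (rule fundamental_theorem_of_calculus)
    fix \<theta> :: real
    have "(\<phi> has_vector_derivative \<mu> - z * of_real (cos \<theta>)) (at \<theta> within {0..pi})"
      unfolding \<phi>_def[abs_def] by (auto intro!: derivative_eq_intros)
    moreover have "((\<lambda>x. - f' x) has_field_derivative f (\<phi> \<theta>)) (at (\<phi> \<theta>) within \<phi> ` {0..pi})"
      using DERIV_minus[OF deriv_f'] by fastforce
    ultimately show "((\<lambda>\<theta>. - f' (\<phi> \<theta>)) has_vector_derivative (\<mu> - z * of_real (cos \<theta>)) * f (\<phi> \<theta>))
        (at \<theta> within {0..pi})"
      using field_vector_diff_chain_within by (fastforce simp: o_def)
  qed simp
  then have I: "integral {0..pi} (\<lambda>\<theta>. (\<mu> - z * of_real (cos \<theta>)) * f (\<phi> \<theta>)) = f' 0 - f' (of_real pi * \<mu>)"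
    by (simp add: \<phi>_def integral_unique mult.commute)
  have cont: "continuous_on {0..pi} (\<lambda>\<theta>. f (\<phi> \<theta>))"
    unfolding \<phi>_def by (intro continuous_intros continuous_on_compose2[OF cont_f[of UNIV]] subset_UNIV)
  have "(\<lambda>\<theta>. \<mu> * f (\<phi> \<theta>)) integrable_on {0..pi}" "(\<lambda>\<theta>. z * (f (\<phi> \<theta>) * of_real (cos \<theta>))) integrable_on {0..pi}"
    by (intro integrable_continuous_interval continuous_intros cont)+
  from integral_diff[OF this]
  have "integral {0..pi} (\<lambda>\<theta>. (\<mu> - z * of_real (cos \<theta>)) * f (\<phi> \<theta>))
      = \<mu> * integral {0..pi} (\<lambda>\<theta>. f (\<phi> \<theta>)) - z * integral {0..pi} (\<lambda>\<theta>. f (\<phi> \<theta>) * of_real (cos \<theta>))"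
    by (simp add: algebra_simps)
  from this[unfolded I] have "z * integral {0..pi} (\<lambda>\<theta>. f (\<phi> \<theta>) * of_real (cos \<theta>))
      = \<mu> * integral {0..pi} (\<lambda>\<theta>. f (\<phi> \<theta>)) - (f' 0 - f' (of_real pi * \<mu>))"
    by (simp add: algebra_simps)
  then have "2 / of_real pi * (z * integral {0..pi} (\<lambda>\<theta>. f (\<phi> \<theta>) * of_real (cos \<theta>)))
      = 2 / of_real pi * (\<mu> * integral {0..pi} (\<lambda>\<theta>. f (\<phi> \<theta>)) - (f' 0 - f' (of_real pi * \<mu>)))"
    by (simp only:)
  then show "z * (anger_gen f (\<mu> - 1) z + anger_gen f (\<mu> + 1) z)
      = 2 * \<mu> * anger_gen f \<mu> z - 2 * (f' 0 - f' (of_real pi * \<mu>)) / of_real pi"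
    unfolding sum by (simp add: anger_gen_def \<phi>_def diff_divide_distrib right_diff_distrib mult_ac)
qed

text \<open>The boundary function \<open>T\<close> is sin for f = cos and 1 - cos for f = sin. This
  is how one parameter yields both v, w and their variants with a tilde.\<close>

lemma struve_type_recurrence_anger:
  assumes S: "log_branch_on S lg" and T: "\<And>x. T x = f' 0 - f' x"
  shows "struve_type_recurrence S lg (-1) (anger_gen f) (anger_gen_deriv f')
     (\<lambda>\<mu> x. 0) (\<lambda>\<mu> x. - 2 * T (of_real pi * \<mu>) / (of_real pi * x)) (v_gen T lg) (w_gen T lg)"
proof
  fix x assume x: "x \<in> S"
  have x0: "x \<noteq> 0" "exp (lg x) = x" using log_branchD[OF S] x by auto
  fix \<mu> :: complex
  show "(anger_gen f \<mu> has_field_derivative anger_gen_deriv f' \<mu> x) (at x)"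
    by (rule deriv_anger_gen)
  show "anger_gen f (\<mu> - 1) x + -1 * anger_gen f (\<mu> + 1) x = 2 * anger_gen_deriv f' \<mu> x + 0"
    using anger_gen_recurrences(1)[of \<mu> x] by simp
  have "anger_gen f (\<mu> - 1) x + anger_gen f (\<mu> + 1) x
      = (2 * \<mu> * anger_gen f \<mu> x - 2 * T (of_real pi * \<mu>) / of_real pi) / x"
    using anger_gen_recurrences(2)[of x \<mu>] x0 by (simp add: T eq_divide_eq mult.commute)
  then show "anger_gen f (\<mu> - 1) x - -1 * anger_gen f (\<mu> + 1) x
      = 2 * \<mu> / x * anger_gen f \<mu> x + - 2 * T (of_real pi * \<mu>) / (of_real pi * x)"
    by (simp add: diff_divide_distrib)
  fix l :: nat and \<nu> :: complex
  have v: "cpow lg x (- \<nu> - of_nat 0 - 1) = 1 / (cpow lg x \<nu> * x)"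
    using x0 by (simp add: cpow_diff cpow_1 cpow_minus)
  show "v_gen T lg \<nu> l 0 x = (ratio \<nu> l * (- 2 * T (of_real pi * (\<nu> + of_nat l)) / (of_real pi * x)) - 0)
      / (2 * cpow lg x \<nu>)"
    unfolding v_gen_def v ratio_def[symmetric] by (simp add: desc_fact_def)
  have w: "cpow lg x (\<nu> - of_nat 0 - 1) = cpow lg x \<nu> / x"
    using x0 by (simp add: cpow_diff cpow_1)
  have r: "(if \<nu> = 0 \<and> l = 0 then 1 else \<nu> / (\<nu> - of_nat l)) = ratio (- \<nu>) l"
    using minus_divide_divide[of \<nu> "\<nu> - of_nat l"] by (simp add: ratio_def)
  show "w_gen T lg \<nu> l 0 x = - (ratio (- \<nu>) l * (- 2 * T (of_real pi * (\<nu> - of_nat l)) / (of_real pi * x)) + 0)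
      * cpow lg x \<nu> / 2"
    unfolding w_gen_def w r by (simp add: desc_fact_def)
next
  fix x \<nu> :: complex and l m :: nat assume x: "x \<in> S"
  have e: "- \<nu> - of_nat m - 1 = (- \<nu> - 1) - of_nat m" "\<nu> - of_nat m - 1 = (\<nu> - 1) - of_nat m" for m
    by simp_all
  show "(v_gen T lg \<nu> l m has_field_derivative v_gen T lg \<nu> l (Suc m) x) (at x)"
    unfolding v_gen_def e by (rule has_field_derivative_desc_fact_cpow[OF S x])
  show "(w_gen T lg \<nu> l m has_field_derivative w_gen T lg \<nu> l (Suc m) x) (at x)"
    unfolding w_gen_def e by (rule has_field_derivative_desc_fact_cpow[OF S x])
qed (use S in auto)

end

text \<open>For n = 0 truncated subtraction makes {1..2*n-1} empty, in agreement with the convention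
  for [-1]; the range j < n + 1 is the sum over j from 0 to n.\<close>

theorem corollary3p3:
  fixes S :: "complex set" and lg :: "complex \<Rightarrow> complex"
    and \<nu> z :: complex and n :: nat
  assumes "log_branch_on S lg" and "z \<in> S"
  shows
    "(\<forall>(G, P, Q) \<in> {(struve_H lg, t_fun lg, u_fun lg),
                        (anger_J, v_fun lg, w_fun lg),
                        (weber_E, v_tilde lg, w_tilde lg)}.
        (\<nu> \<notin> (\<lambda>i. - of_nat i) ` {1..2 * n - 1} \<longrightarrow>
           (deriv ^^ (2 * n)) (\<lambda>x. G \<nu> x / cpow lg x \<nu>) z
           = (\<Sum>k\<le>n. (-1) ^ (n + k) * coeff_A n k \<nu> * (G (\<nu> + 2 * of_nat k) z / cpow lg z \<nu>))
             + (\<Sum>j<n. \<Sum>k\<le>j. (-1) ^ (k + j) * coeff_A j k \<nu> * P \<nu> (2 * k) (2 * n - 2 * j - 1) z)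
             + (\<Sum>j<n. \<Sum>k\<le>j. (-1) ^ (k + j + 1) * coeff_B j k \<nu> * P \<nu> (2 * k + 1) (2 * n - 2 * j - 2) z)) \<and>
        (\<nu> \<notin> (\<lambda>i. - of_nat i) ` {1..2 * n} \<longrightarrow>
           (deriv ^^ (2 * n + 1)) (\<lambda>x. G \<nu> x / cpow lg x \<nu>) z
           = (\<Sum>k\<le>n. (-1) ^ (n + k + 1) * coeff_B n k \<nu> * (G (\<nu> + 2 * of_nat k + 1) z / cpow lg z \<nu>))
             + (\<Sum>j<n + 1. \<Sum>k\<le>j. (-1) ^ (k + j) * coeff_A j k \<nu> * P \<nu> (2 * k) (2 * n - 2 * j) z)
             + (\<Sum>j<n. \<Sum>k\<le>j. (-1) ^ (k + j + 1) * coeff_B j k \<nu> * P \<nu> (2 * k + 1) (2 * n - 2 * j - 1) z)) \<and>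
        (\<nu> \<notin> of_nat ` {1..2 * n - 1} \<longrightarrow>
           (deriv ^^ (2 * n)) (\<lambda>x. cpow lg x \<nu> * G \<nu> x) z
           = (\<Sum>k\<le>n. (-1) ^ (n + k) * coeff_A n k (- \<nu>) * (cpow lg z \<nu> * G (\<nu> - 2 * of_nat k) z))
             + (\<Sum>j<n. \<Sum>k\<le>j. (-1) ^ (k + j) * coeff_A j k (- \<nu>) * Q \<nu> (2 * k) (2 * n - 2 * j - 1) z)
             + (\<Sum>j<n. \<Sum>k\<le>j. (-1) ^ (k + j) * coeff_B j k (- \<nu>) * Q \<nu> (2 * k + 1) (2 * n - 2 * j - 2) z)) \<and>
        (\<nu> \<notin> of_nat ` {1..2 * n} \<longrightarrow>
           (deriv ^^ (2 * n + 1)) (\<lambda>x. cpow lg x \<nu> * G \<nu> x) z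
           = (\<Sum>k\<le>n. (-1) ^ (n + k) * coeff_B n k (- \<nu>) * (cpow lg z \<nu> * G (\<nu> - 2 * of_nat k - 1) z))
             + (\<Sum>j<n + 1. \<Sum>k\<le>j. (-1) ^ (k + j) * coeff_A j k (- \<nu>) * Q \<nu> (2 * k) (2 * n - 2 * j) z)
             + (\<Sum>j<n. \<Sum>k\<le>j. (-1) ^ (k + j) * coeff_B j k (- \<nu>) * Q \<nu> (2 * k + 1) (2 * n - 2 * j - 1) z)))
     \<and>
     ((\<nu> \<notin> (\<lambda>i. - of_nat i) ` {1..2 * n - 1} \<longrightarrow>
         (deriv ^^ (2 * n)) (\<lambda>x. struve_L lg \<nu> x / cpow lg x \<nu>) z
         = (\<Sum>k\<le>n. coeff_A n k \<nu> * (struve_L lg (\<nu> + 2 * of_nat k) z / cpow lg z \<nu>))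
           + (\<Sum>j<n. \<Sum>k\<le>j. coeff_A j k \<nu> * t_fun lg \<nu> (2 * k) (2 * n - 2 * j - 1) z)
           + (\<Sum>j<n. \<Sum>k\<le>j. coeff_B j k \<nu> * t_fun lg \<nu> (2 * k + 1) (2 * n - 2 * j - 2) z)) \<and>
      (\<nu> \<notin> (\<lambda>i. - of_nat i) ` {1..2 * n} \<longrightarrow>
         (deriv ^^ (2 * n + 1)) (\<lambda>x. struve_L lg \<nu> x / cpow lg x \<nu>) z
         = (\<Sum>k\<le>n. coeff_B n k \<nu> * (struve_L lg (\<nu> + 2 * of_nat k + 1) z / cpow lg z \<nu>))
           + (\<Sum>j<n + 1. \<Sum>k\<le>j. coeff_A j k \<nu> * t_fun lg \<nu> (2 * k) (2 * n - 2 * j) z)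
           + (\<Sum>j<n. \<Sum>k\<le>j. coeff_B j k \<nu> * t_fun lg \<nu> (2 * k + 1) (2 * n - 2 * j - 1) z)) \<and>
      (\<nu> \<notin> of_nat ` {1..2 * n - 1} \<longrightarrow>
         (deriv ^^ (2 * n)) (\<lambda>x. cpow lg x \<nu> * struve_L lg \<nu> x) z
         = (\<Sum>k\<le>n. coeff_A n k (- \<nu>) * (cpow lg z \<nu> * struve_L lg (\<nu> - 2 * of_nat k) z))
           + (\<Sum>j<n. \<Sum>k\<le>j. coeff_A j k (- \<nu>) * u_fun lg \<nu> (2 * k) (2 * n - 2 * j - 1) z)
           + (\<Sum>j<n. \<Sum>k\<le>j. coeff_B j k (- \<nu>) * u_fun lg \<nu> (2 * k + 1) (2 * n - 2 * j - 2) z)) \<and>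
      (\<nu> \<notin> of_nat ` {1..2 * n} \<longrightarrow>
         (deriv ^^ (2 * n + 1)) (\<lambda>x. cpow lg x \<nu> * struve_L lg \<nu> x) z
         = (\<Sum>k\<le>n. coeff_B n k (- \<nu>) * (cpow lg z \<nu> * struve_L lg (\<nu> - 2 * of_nat k - 1) z))
           + (\<Sum>j<n + 1. \<Sum>k\<le>j. coeff_A j k (- \<nu>) * u_fun lg \<nu> (2 * k) (2 * n - 2 * j) z)
           + (\<Sum>j<n. \<Sum>k\<le>j. coeff_B j k (- \<nu>) * u_fun lg \<nu> (2 * k + 1) (2 * n - 2 * j - 1) z)))"
proof -
  note S = assms(1)
  have H: "struve_H lg = struve_gen (- 1) lg" and L: "struve_L lg = struve_gen 1 lg"
    by (auto simp: fun_eq_iff struve_H_def struve_L_def struve_gen_def struve_term_def)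
  have J: "anger_J = anger_gen cos" and E: "weber_E = anger_gen sin"
    by (auto simp: fun_eq_iff anger_J_def weber_E_def anger_gen_def)
  interpret H: struve_type_recurrence S lg "- 1" "struve_gen (- 1) lg" "struve_gen_deriv (- 1) lg"
      "\<lambda>\<mu> x. - struve_inhom lg \<mu> x" "struve_inhom lg" "t_fun lg" "u_fun lg"
    by (rule struve_type_recurrence_struve[OF S]) simp
  interpret L: struve_type_recurrence S lg 1 "struve_gen 1 lg" "struve_gen_deriv 1 lg"
      "\<lambda>\<mu> x. - struve_inhom lg \<mu> x" "struve_inhom lg" "t_fun lg" "u_fun lg"
    by (rule struve_type_recurrence_struve[OF S]) simp
  interpret J: struve_type_recurrence S lg "- 1" "anger_gen cos" "anger_gen_deriv (\<lambda>x. - sin x)"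
      "\<lambda>\<mu> x. 0" "\<lambda>\<mu> x. - 2 * sin (of_real pi * \<mu>) / (of_real pi * x)" "v_fun lg" "w_fun lg"
    by (rule trig_pair.struve_type_recurrence_anger[OF _ S]) (auto simp: trig_pair_def)
  interpret E: struve_type_recurrence S lg "- 1" "anger_gen sin" "anger_gen_deriv cos"
      "\<lambda>\<mu> x. 0" "\<lambda>\<mu> x. - 2 * (1 - cos (of_real pi * \<mu>)) / (of_real pi * x)" "v_tilde lg" "w_tilde lg"
    by (rule trig_pair.struve_type_recurrence_anger[OF _ S]) (auto simp: trig_pair_def)
  note H' = H.higher_deriv_quotient[OF assms(2), of \<nu> n] H.higher_deriv_product[OF assms(2), of \<nu> n]
  note L' = L.higher_deriv_quotient[OF assms(2), of \<nu> n] L.higher_deriv_product[OF assms(2), of \<nu> n]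
  note J' = J.higher_deriv_quotient[OF assms(2), of \<nu> n] J.higher_deriv_product[OF assms(2), of \<nu> n]
  note E' = E.higher_deriv_quotient[OF assms(2), of \<nu> n] E.higher_deriv_product[OF assms(2), of \<nu> n]
  show ?thesis
    unfolding H L J E ball_simps prod.case
    by (intro conjI TrueI H' J' E' L'[unfolded power_one mult_1_left])
qed

end
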